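(* Let $k$ be a field of characteristic different from $2$ and let $L/k$ be a finite Galois extension with Galois group $G$. Then the Dress map $h_{L/k}\colon A(G)\to GW(k)$ is surjective if and only if $k$ is quadratically closed in $L$, i.e. every element of $k$ is a square in $L$.
   Context: $A(G)$ is the Burnside ring of the finite group $G$: as an abelian group it is free on the classes $G/H$, with $H$ running over representatives of conjugacy classes of subgroups of $G$; addition is disjoint union and multiplication is cartesian product, with identity $G/G$. $GW(k)$ is the Grothendieck–Witt ring of $k$, generated as an abelian group by the one-dimensional forms $\langle a\rangle$, $a\in k^\times/(k^\times)^2$, with $\langle a\rangle+\langle b\rangle=\langle a,b\rangle$ (orthogonal sum) and $\langle a\rangle\langle b\rangle=\langle ab\rangle$. The Dress map $h_{L/k}$ is the ring homomorphism sending $G/H$ to the trace form $\mathrm{tr}_{L^H/k}\langle 1\rangle_{L^H}$, i.e. the class of the quadratic form $x\mapsto \mathrm{tr}_{L^H/k}(x^2)$ on the $k$-vector space $L^H$. *)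

theory Defs
  imports "Jordan_Normal_Form.Determinant"
begin

section \<open>Field extensions L/k, modelled by a field embedding iota : k -> L\<close>

definition field_hom :: "('k::field \<Rightarrow> 'l::field) \<Rightarrow> bool" where
  "field_hom \<iota> \<longleftrightarrow> \<iota> 1 = 1 \<and> (\<forall>a b. \<iota> (a + b) = \<iota> a + \<iota> b \<and> \<iota> (a * b) = \<iota> a * \<iota> b)"

definition kbasis :: "('k::field \<Rightarrow> 'l::field) \<Rightarrow> 'l set \<Rightarrow> (nat \<Rightarrow> 'l) \<Rightarrow> nat \<Rightarrow> bool" where
  "kbasis \<iota> V e m \<longleftrightarrow> (\<forall>i<m. e i \<in> V) \<and>
     (\<forall>x\<in>V. \<exists>!c. (\<forall>i\<ge>m. c i = 0) \<and> x = (\<Sum>i<m. \<iota> (c i) * e i))"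

definition kcoord :: "('k::field \<Rightarrow> 'l::field) \<Rightarrow> (nat \<Rightarrow> 'l) \<Rightarrow> nat \<Rightarrow> 'l \<Rightarrow> nat \<Rightarrow> 'k" where
  "kcoord \<iota> e m x = (THE c. (\<forall>i\<ge>m. c i = 0) \<and> x = (\<Sum>i<m. \<iota> (c i) * e i))"

definition chosen_basis :: "('k::field \<Rightarrow> 'l::field) \<Rightarrow> 'l set \<Rightarrow> (nat \<Rightarrow> 'l) \<times> nat" where
  "chosen_basis \<iota> V = (SOME (e, m). kbasis \<iota> V e m)"

text \<open>Trace over k of multiplication by y on the finite-dimensional k-space V
  (V a subfield of L containing k, e.g. a fixed field L^H): tr_{V/k}(y).\<close>
definition ktrace :: "('k::field \<Rightarrow> 'l::field) \<Rightarrow> 'l set \<Rightarrow> 'l \<Rightarrow> 'k" where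
  "ktrace \<iota> V y = (case chosen_basis \<iota> V of (e, m) \<Rightarrow> (\<Sum>i<m. kcoord \<iota> e m (y * e i) i))"

definition trace_form :: "('k::field \<Rightarrow> 'l::field) \<Rightarrow> 'l set \<Rightarrow> 'k mat" where
  "trace_form \<iota> V = (case chosen_basis \<iota> V of (e, m) \<Rightarrow>
      mat m m (\<lambda>(i, j). ktrace \<iota> V (e i * e j)))"

definition galois_group :: "('k::field \<Rightarrow> 'l::field) \<Rightarrow> ('l \<Rightarrow> 'l) set" where
  "galois_group \<iota> = {\<sigma>. bij \<sigma> \<and> (\<forall>x y. \<sigma> (x + y) = \<sigma> x + \<sigma> y \<and> \<sigma> (x * y) = \<sigma> x * \<sigma> y)
                        \<and> (\<forall>a. \<sigma> (\<iota> a) = \<iota> a)}"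

definition fixed_field :: "('l \<Rightarrow> 'l) set \<Rightarrow> 'l set" where
  "fixed_field H = {x. \<forall>\<sigma>\<in>H. \<sigma> x = x}"

definition finite_galois :: "('k::field \<Rightarrow> 'l::field) \<Rightarrow> bool" where
  "finite_galois \<iota> \<longleftrightarrow> (\<exists>e m. kbasis \<iota> UNIV e m) \<and> fixed_field (galois_group \<iota>) = range \<iota>"

definition gal_subgroup :: "('k::field \<Rightarrow> 'l::field) \<Rightarrow> ('l \<Rightarrow> 'l) set \<Rightarrow> bool" where
  "gal_subgroup \<iota> H \<longleftrightarrow> H \<subseteq> galois_group \<iota> \<and> id \<in> H \<and>
     (\<forall>\<sigma>\<in>H. \<forall>\<tau>\<in>H. \<sigma> \<circ> \<tau> \<in> H) \<and> (\<forall>\<sigma>\<in>H. inv_into UNIV \<sigma> \<in> H)"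

definition conj_class :: "('k::field \<Rightarrow> 'l::field) \<Rightarrow> ('l \<Rightarrow> 'l) set \<Rightarrow> ('l \<Rightarrow> 'l) set set" where
  "conj_class \<iota> H = {(\<lambda>\<tau>. \<sigma> \<circ> \<tau> \<circ> inv_into UNIV \<sigma>) ` H | \<sigma>. \<sigma> \<in> galois_group \<iota>}"

definition conj_classes :: "('k::field \<Rightarrow> 'l::field) \<Rightarrow> ('l \<Rightarrow> 'l) set set set" where
  "conj_classes \<iota> = {conj_class \<iota> H | H. gal_subgroup \<iota> H}"

text \<open>A chosen representative H of a conjugacy class (corresponding to the basis element G/H).\<close>
definition class_rep :: "('l \<Rightarrow> 'l) set set \<Rightarrow> ('l \<Rightarrow> 'l) set" where
  "class_rep C = (SOME H. H \<in> C)"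

text \<open>A(G) as an abelian group: free on the conjugacy classes, i.e. integer-valued
  functions on the set of conjugacy classes of subgroups (a finite set).\<close>
definition burnside :: "('k::field \<Rightarrow> 'l::field) \<Rightarrow> (('l \<Rightarrow> 'l) set set \<Rightarrow> int) set" where
  "burnside \<iota> = {c. \<forall>C. C \<notin> conj_classes \<iota> \<longrightarrow> c C = 0}"

definition qform :: "'k::field mat \<Rightarrow> bool" where
  "qform A \<longleftrightarrow> A \<in> carrier_mat (dim_row A) (dim_row A) \<and> transpose_mat A = A \<and> det A \<noteq> 0"

definition isometric :: "'k::field mat \<Rightarrow> 'k mat \<Rightarrow> bool" where
  "isometric A B \<longleftrightarrow> (\<exists>P. P \<in> carrier_mat (dim_row A) (dim_row A) \<and> det P \<noteq> 0 \<and>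
                         transpose_mat P * A * P = B)"

definition osum :: "'k::field mat \<Rightarrow> 'k mat \<Rightarrow> 'k mat" where
  "osum A B = four_block_mat A (0\<^sub>m (dim_row A) (dim_col B)) (0\<^sub>m (dim_row B) (dim_col A)) B"

definition gw_free :: "('k::field mat \<Rightarrow> int) set" where
  "gw_free = {f. finite {A. f A \<noteq> 0} \<and> (\<forall>A. f A \<noteq> 0 \<longrightarrow> qform A)}"

definition delta :: "'a \<Rightarrow> 'a \<Rightarrow> int" where
  "delta A = (\<lambda>B. if B = A then 1 else 0)"

text \<open>Subgroup of relations: isometric forms are identified, and orthogonal sum is addition.
  GW(k) is gw_free modulo gw_rel (Grothendieck group of isometry classes).\<close>
inductive_set gw_rel :: "('k::field mat \<Rightarrow> int) set" where
  zero: "(\<lambda>_. 0) \<in> gw_rel"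
| iso: "qform A \<Longrightarrow> qform B \<Longrightarrow> isometric A B \<Longrightarrow> (\<lambda>X. delta A X - delta B X) \<in> gw_rel"
| sum: "qform A \<Longrightarrow> qform B \<Longrightarrow> (\<lambda>X. delta (osum A B) X - delta A X - delta B X) \<in> gw_rel"
| add: "f \<in> gw_rel \<Longrightarrow> g \<in> gw_rel \<Longrightarrow> (\<lambda>X. f X + g X) \<in> gw_rel"
| neg: "f \<in> gw_rel \<Longrightarrow> (\<lambda>X. - f X) \<in> gw_rel"

definition gw_eq :: "('k::field mat \<Rightarrow> int) \<Rightarrow> ('k mat \<Rightarrow> int) \<Rightarrow> bool" where
  "gw_eq f g \<longleftrightarrow> (\<lambda>X. f X - g X) \<in> gw_rel"

text \<open>h(sum_C c_C [G/H_C]) = sum_C c_C [tr_{L^{H_C}/k} <1>], lifted to the free group.\<close>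
definition dress :: "('k::field \<Rightarrow> 'l::field) \<Rightarrow> (('l \<Rightarrow> 'l) set set \<Rightarrow> int) \<Rightarrow> ('k mat \<Rightarrow> int)" where
  "dress \<iota> c = (\<lambda>X. \<Sum>C\<in>conj_classes \<iota>. c C * delta (trace_form \<iota> (fixed_field (class_rep C))) X)"

definition dress_surjective :: "('k::field \<Rightarrow> 'l::field) \<Rightarrow> bool" where
  "dress_surjective \<iota> \<longleftrightarrow> (\<forall>f\<in>gw_free. \<exists>c\<in>burnside \<iota>. gw_eq (dress \<iota> c) f)"

end

theory Submission
  imports Defs
begin

text \<open>Modulo squares in \<open>k\<close>, the determinant is a homomorphism from \<open>GW(k)\<close>. The trace form of an
  intermediate field \<open>V\<close> has determinant \<open>(det (f s (e j)))\<^sup>2\<close>, with \<open>f s\<close> running through the embeddings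
  \<open>V \<rightarrow> L\<close>, which is a square in \<open>L\<close>. Hence a form \<open>\<langle>a\<rangle>\<close> in the image of the Dress map forces \<open>a\<close> to be
  a square in \<open>L\<close>. Conversely \<open>GW(k)\<close> is generated by the forms \<open>\<langle>a\<rangle>\<close>, and for each nonsquare \<open>a\<close> with a
  square root in \<open>L\<close> the trace form of \<open>k(\<surd>a)\<close> is \<open>\<langle>2\<rangle> + \<langle>2a\<rangle>\<close>. Taking \<open>a = 2\<close> gives \<open>\<langle>2\<rangle>\<close>, because \<open>\<langle>4\<rangle> = \<langle>1\<rangle>\<close>
  is the trace form of \<open>k\<close>; thus all \<open>\<langle>2a\<rangle>\<close> are in the image, and these are all the rank one forms.\<close>

subsection \<open>Quadratic forms and the Grothendieck-Witt group\<close>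

abbreviation rank_one_form :: "'k::field \<Rightarrow> 'k mat" where
  "rank_one_form a \<equiv> mat 1 1 (\<lambda>_. a)"

lemma qform_rank_one: "a \<noteq> 0 \<Longrightarrow> qform (rank_one_form a)"
  by (auto simp: qform_def det_single intro!: eq_matI)

lemma det_osum:
  assumes "A \<in> carrier_mat n n" "B \<in> carrier_mat m m"
  shows "det (osum A B) = det A * det B"
  using assms unfolding osum_def by (intro det_four_block_mat_upper_right_zero) auto

lemma transpose_osum:
  assumes "A \<in> carrier_mat n n" "B \<in> carrier_mat m m"
  shows "transpose_mat (osum A B) = osum (transpose_mat A) (transpose_mat B)"
  using assms by (simp add: osum_def transpose_four_block_mat[of _ n n _ m _ m])

lemma qform_iff: "A \<in> carrier_mat n n \<Longrightarrow> qform A \<longleftrightarrow> transpose_mat A = A \<and> det A \<noteq> 0"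
  using carrier_matD(1) unfolding qform_def by metis

lemma qform_cases:
  assumes "qform A"
  obtains n where "A \<in> carrier_mat n n" "dim_row A = n" "transpose_mat A = A" "det A \<noteq> 0"
  using assms unfolding qform_def by blast

lemma osum_carrier:
  "A \<in> carrier_mat n n \<Longrightarrow> B \<in> carrier_mat m m \<Longrightarrow> osum A B \<in> carrier_mat (n + m) (n + m)"
  by (auto simp: osum_def)

lemma qform_osum:
  assumes "qform A" "qform B"
  shows "qform (osum A B)"
proof -
  obtain n where A: "A \<in> carrier_mat n n" "transpose_mat A = A" "det A \<noteq> 0"
    using assms(1) by (rule qform_cases)
  obtain m where B: "B \<in> carrier_mat m m" "transpose_mat B = B" "det B \<noteq> 0"
    using assms(2) by (rule qform_cases)
  show ?thesis
    unfolding qform_iff[OF osum_carrier[OF A(1) B(1)]]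
    using transpose_osum[OF A(1) B(1)] det_osum[OF A(1) B(1)] A(2,3) B(2,3) by simp
qed

text \<open>The induction that diagonalises a form needs the complement of a split summand to be a
  form again. Symmetry is read off block by block, and nondegeneracy follows because the determinant
  of the sum is the product of the two determinants.\<close>

lemma qform_osumD:
  assumes "qform (osum A B)" "A \<in> carrier_mat n n" "B \<in> carrier_mat m m"
  shows "qform A" "qform B"
proof -
  have "transpose_mat (osum A B) = osum (transpose_mat A) (transpose_mat B)"
    by (rule transpose_osum[OF assms(2,3)])
  then have eq: "osum (transpose_mat A) (transpose_mat B) = osum A B"
    using assms(1) by (simp add: qform_def)
  have "transpose_mat A = A"
  proof (rule eq_matI)
    fix i j assume "i < dim_row A" "j < dim_col A"
    then show "transpose_mat A $$ (i, j) = A $$ (i, j)"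
      using arg_cong[OF eq, of "\<lambda>M. M $$ (i, j)"] assms(2,3) by (auto simp: osum_def)
  qed (use assms(2) in auto)
  moreover have "transpose_mat B = B"
  proof (rule eq_matI)
    fix i j assume "i < dim_row B" "j < dim_col B"
    then show "transpose_mat B $$ (i, j) = B $$ (i, j)"
      using arg_cong[OF eq, of "\<lambda>M. M $$ (n + i, n + j)"] assms(2,3) by (auto simp: osum_def)
  qed (use assms(3) in auto)
  moreover have "det A \<noteq> 0" "det B \<noteq> 0"
    using assms(1) by (auto simp: qform_def det_osum[OF assms(2,3)])
  ultimately show "qform A" "qform B"
    by (simp_all add: qform_iff[OF assms(2)] qform_iff[OF assms(3)])
qed

lemma det_congruence:
  assumes "A \<in> carrier_mat n n" "P \<in> carrier_mat n n"
  shows "det (transpose_mat P * A * P) = (det P)\<^sup>2 * det (A :: 'k::field mat)"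
  using assms by (simp add: det_mult[of _ n] det_transpose[of _ n] power2_eq_square)

lemma qform_congruence:
  assumes "qform A" "P \<in> carrier_mat (dim_row A) (dim_row A)" "det P \<noteq> 0"
  shows "qform (transpose_mat P * A * P)"
proof -
  obtain n where n: "dim_row A = n" by blast
  have A: "A \<in> carrier_mat n n" "transpose_mat A = A" "det A \<noteq> 0"
    using assms(1) unfolding qform_def n by blast+
  have P: "P \<in> carrier_mat n n" using assms(2) n by simp
  have "transpose_mat (transpose_mat P * A * P) = transpose_mat P * transpose_mat (transpose_mat P * A)"
    by (rule transpose_mult) (use A P in auto)
  also have "transpose_mat (transpose_mat P * A) = A * P"
    using A P by (subst transpose_mult[of _ n n _ n]) auto
  also have "transpose_mat P * (A * P) = transpose_mat P * A * P"
    by (rule assoc_mult_mat[symmetric]) (use A P in auto)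
  finally have "transpose_mat (transpose_mat P * A * P) = transpose_mat P * A * P" .
  moreover have "det (transpose_mat P * A * P) \<noteq> 0"
    using A(3) assms(3) by (simp add: det_congruence[OF A(1) P])
  moreover have "transpose_mat P * A * P \<in> carrier_mat n n" using A P by simp
  ultimately show ?thesis by (simp add: qform_iff)
qed

section \<open>Splitting a rank one summand off a symmetric matrix\<close>

lemma congruence_entry:
  assumes "A \<in> carrier_mat n n" "P \<in> carrier_mat n n" "i < n" "j < n"
  shows "(transpose_mat P * A * P) $$ (i, j) = (\<Sum>k<n. \<Sum>l<n. P $$ (k, i) * A $$ (k, l) * P $$ (l, j))"
  using assms by (simp add: scalar_prod_def sum_distrib_left mult.assoc atLeast0LessThan)

text \<open>A nondegenerate symmetric form in characteristic other than 2 represents a nonzero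
  value. If the corner vanishes, some \<open>A $$ (0, i)\<close> does not, and the form is evaluated
  at e_0 + e_i and e_0 - e_i; the two values differ by 4 times that entry, so they cannot both be
  0.\<close>

lemma qform_nonzero_corner:
  assumes two: "(2::'k::field) \<noteq> 0" and A: "qform (A :: 'k mat)" "dim_row A = Suc n"
  obtains P where "P \<in> carrier_mat (Suc n) (Suc n)" "det P \<noteq> 0"
    "(transpose_mat P * A * P) $$ (0, 0) \<noteq> 0"
proof (cases "A $$ (0, 0) = 0")
  case False
  have "A \<in> carrier_mat (Suc n) (Suc n)" using A by (auto simp: qform_def)
  with that[of "1\<^sub>m (Suc n)"] False show ?thesis by simp
next
  case True
  have AC: "A \<in> carrier_mat (Suc n) (Suc n)" and AT: "transpose_mat A = A" and dA: "det A \<noteq> 0"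
    using A by (auto simp: qform_def)
  have "\<exists>i<Suc n. A $$ (0, i) \<noteq> 0"
  proof (rule ccontr)
    assume "\<not> ?thesis"
    then have z: "\<And>i. i < Suc n \<Longrightarrow> A $$ (0, i) = 0" by auto
    have "A $$ (i, 0) = 0" if "i < Suc n" for i
      using arg_cong[OF AT, of "\<lambda>M. M $$ (i, 0)"] AC z[OF that] that by auto
    then have "A *\<^sub>v unit_vec (Suc n) 0 = 0\<^sub>v (Suc n)"
      using AC by (intro eq_vecI) auto
    moreover have "unit_vec (Suc n) 0 \<noteq> (0\<^sub>v (Suc n) :: 'k vec)"
      by (metis index_unit_vec(2) index_zero_vec(1) zero_less_Suc zero_neq_one)
    ultimately show False
      using dA det_0_iff_vec_prod_zero[OF AC] unit_vec_carrier by blast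
  qed
  then obtain i where i: "i < Suc n" "A $$ (0, i) \<noteq> 0" by blast
  have i0: "i \<noteq> 0"
  proof
    assume "i = 0"
    with i(2) True show False by simp
  qed
  have Ai0: "A $$ (i, 0) = A $$ (0, i)"
    using arg_cong[OF AT, of "\<lambda>M. M $$ (i, 0)"] AC i by auto
  \<comment> \<open>Column 0 of this matrix is e_0 + s e_i, so the new corner is the value of the
    form at that vector.\<close>
  let ?P = "\<lambda>s. addrow_mat (Suc n) s i 0 :: 'k mat"
  have PC: "?P s \<in> carrier_mat (Suc n) (Suc n)" "det (?P s) \<noteq> 0" for s
    using i0 by (simp_all add: det_addrow_mat)
  have corner: "(transpose_mat (?P s) * A * ?P s) $$ (0, 0) = 2 * s * A $$ (0, i) + s\<^sup>2 * A $$ (i, i)" for s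
  proof -
    have P: "?P s $$ (k, 0) = (if k = 0 then 1 else if k = i then s else 0)" if "k < Suc n" for k
      using that i0 i by (auto simp: addrow_mat_def)
    have split: "(\<Sum>k<Suc n. (if k = 0 then 1 else if k = i then s else 0) * f k) = f 0 + s * f i" for f
    proof -
      have "(\<Sum>k<Suc n. (if k = 0 then 1 else if k = i then s else 0) * f k)
        = (\<Sum>k<Suc n. (if k = 0 then f k else 0) + (if k = i then s * f k else 0))"
        by (intro sum.cong) (use i0 in auto)
      also have "\<dots> = f 0 + s * f i" using i by (simp add: sum.distrib)
      finally show ?thesis .
    qed
    let ?c = "\<lambda>k. if k = 0 then 1 else if k = i then s else 0"
    have "(transpose_mat (?P s) * A * ?P s) $$ (0, 0)
       = (\<Sum>k<Suc n. \<Sum>l<Suc n. ?P s $$ (k, 0) * A $$ (k, l) * ?P s $$ (l, 0))"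
      by (rule congruence_entry[OF AC PC(1)]) simp_all
    also have "\<dots> = (\<Sum>k<Suc n. \<Sum>l<Suc n. ?c k * (?c l * A $$ (k, l)))"
      by (intro sum.cong refl) (simp only: P lessThan_iff mult_ac)
    also have "\<dots> = (\<Sum>k<Suc n. ?c k * (\<Sum>l<Suc n. ?c l * A $$ (k, l)))"
      by (simp only: sum_distrib_left)
    also have "\<dots> = 2 * s * A $$ (0, i) + s\<^sup>2 * A $$ (i, i)"
      unfolding split using True Ai0 by (simp add: algebra_simps power2_eq_square)
    finally show ?thesis .
  qed
  show ?thesis
  proof (cases "(transpose_mat (?P 1) * A * ?P 1) $$ (0, 0) = 0")
    case True
    then have e: "2 * A $$ (0, i) + A $$ (i, i) = 0" unfolding corner by simp
    have "(transpose_mat (?P (-1)) * A * ?P (-1)) $$ (0, 0) = - (2 * 2 * A $$ (0, i))"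
      unfolding corner using e by (simp add: algebra_simps eq_neg_iff_add_eq_0)
    also have "\<dots> \<noteq> 0" using i two by (metis mult_eq_0_iff neg_equal_0_iff_equal)
    finally show ?thesis by (rule that[OF PC])
  qed (rule that[OF PC])
qed

text \<open>One step of symmetric Gaussian elimination: the invertible corner clears its row and
  column, and \<open>B\<close> is its Schur complement.\<close>

lemma qform_split_corner:
  assumes A: "qform (A :: 'k::field mat)" "dim_row A = Suc n" and b: "A $$ (0, 0) \<noteq> 0"
  obtains B where "B \<in> carrier_mat n n" "isometric A (osum (rank_one_form (A $$ (0, 0))) B)"
proof -
  let ?b = "A $$ (0, 0)"
  have AC: "A \<in> carrier_mat (Suc n) (Suc n)" and AT: "transpose_mat A = A"
    using A by (auto simp: qform_def)
  have sym: "A $$ (i, j) = A $$ (j, i)" if "i < Suc n" "j < Suc n" for i j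
    using arg_cong[OF AT, of "\<lambda>M. M $$ (i, j)"] AC that by auto
  define W where "W = mat 1 n (\<lambda>(i, j). A $$ (0, Suc j))"
  define A1 where "A1 = mat n n (\<lambda>(i, j). A $$ (Suc i, Suc j))"
  \<comment> \<open>\<open>U\<close> is -W/b, the solution of b U + W = 0, which makes both
    off-diagonal blocks vanish.\<close>
  define U where "U = mat 1 n (\<lambda>(i, j). - A $$ (0, Suc j) / ?b)"
  note [simp] = W_def A1_def U_def
  let ?d = "rank_one_form ?b"
  let ?P = "four_block_mat (1\<^sub>m 1) U (0\<^sub>m n 1) (1\<^sub>m n)"
  have Ablock: "A = four_block_mat ?d W (transpose_mat W) A1"
  proof (rule eq_matI)
    fix i j assume "i < dim_row (four_block_mat ?d W (transpose_mat W) A1)"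
      "j < dim_col (four_block_mat ?d W (transpose_mat W) A1)"
    then show "A $$ (i, j) = four_block_mat ?d W (transpose_mat W) A1 $$ (i, j)"
      using sym by (cases i; cases j) auto
  qed (use AC in auto)
  have P: "?P \<in> carrier_mat (Suc n) (Suc n)" by auto
  have dP: "det ?P = 1"
    by (subst det_four_block_mat_lower_left_zero[of _ 1 _ n]) auto
  have PT: "transpose_mat ?P = four_block_mat (1\<^sub>m 1) (0\<^sub>m 1 n) (transpose_mat U) (1\<^sub>m n)"
    by (subst transpose_four_block_mat[of _ 1 1 _ n _ n]) auto
  have z1: "?d * U + W = 0\<^sub>m 1 n"
    using b by (intro eq_matI) (auto simp: scalar_prod_def)
  have z2: "transpose_mat U * ?d + transpose_mat W = 0\<^sub>m n 1"
    using b by (intro eq_matI) (auto simp: scalar_prod_def)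
  let ?B = "transpose_mat U * W + A1"
  have PA: "transpose_mat ?P * A = four_block_mat ?d W (0\<^sub>m n 1) ?B"
  proof -
    have "transpose_mat ?P * A
      = four_block_mat (1\<^sub>m 1 * ?d + 0\<^sub>m 1 n * transpose_mat W) (1\<^sub>m 1 * W + 0\<^sub>m 1 n * A1)
          (transpose_mat U * ?d + 1\<^sub>m n * transpose_mat W) (transpose_mat U * W + 1\<^sub>m n * A1)"
      unfolding PT by (subst Ablock, rule mult_four_block_mat[of _ 1 1 _ n _ n _ _ 1 _ n]) auto
    also have "\<dots> = four_block_mat ?d W (0\<^sub>m n 1) ?B"
    proof -
      have "1\<^sub>m 1 * ?d + 0\<^sub>m 1 n * transpose_mat W = ?d" "1\<^sub>m 1 * W + 0\<^sub>m 1 n * A1 = W"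
        "1\<^sub>m n * A1 = A1" "1\<^sub>m n * transpose_mat W = transpose_mat W"
        by (auto simp del: One_nat_def intro!: eq_matI)
      then show ?thesis using z2 by simp
    qed
    finally show ?thesis .
  qed
  have "transpose_mat ?P * A * ?P
      = four_block_mat (?d * 1\<^sub>m 1 + W * 0\<^sub>m n 1) (?d * U + W * 1\<^sub>m n)
          (0\<^sub>m n 1 * 1\<^sub>m 1 + ?B * 0\<^sub>m n 1) (0\<^sub>m n 1 * U + ?B * 1\<^sub>m n)"
    unfolding PA by (rule mult_four_block_mat[of _ 1 1 _ n _ n _ _ 1 _ n]) auto
  also have "\<dots> = four_block_mat ?d (0\<^sub>m 1 n) (0\<^sub>m n 1) ?B"
  proof -
    have "?d * 1\<^sub>m 1 + W * 0\<^sub>m n 1 = ?d" "W * 1\<^sub>m n = W"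
        "0\<^sub>m n 1 * 1\<^sub>m 1 + ?B * 0\<^sub>m n 1 = 0\<^sub>m n 1" "0\<^sub>m n 1 * U + ?B * 1\<^sub>m n = ?B"
      by (auto simp del: One_nat_def intro!: eq_matI)
    then show ?thesis using z1 by simp
  qed
  also have "\<dots> = osum ?d ?B" by (simp add: osum_def)
  finally have "isometric A (osum ?d ?B)"
    using P dP AC unfolding isometric_def by (intro exI[of _ ?P]) auto
  then show ?thesis by (intro that[of ?B]) auto
qed

lemma isometric_qform: "qform A \<Longrightarrow> isometric A B \<Longrightarrow> qform B"
  unfolding isometric_def using qform_congruence by blast

section \<open>Subgroups containing all relations, which stand for subgroups of GW(k)\<close>

locale gw_subgroup =
  fixes I :: "('k::field mat \<Rightarrow> int) set"
  assumes add: "f \<in> I \<Longrightarrow> g \<in> I \<Longrightarrow> (\<lambda>X. f X + g X) \<in> I"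
    and neg: "f \<in> I \<Longrightarrow> (\<lambda>X. - f X) \<in> I"
    and rel: "f \<in> gw_rel \<Longrightarrow> f \<in> I"
begin

lemma zero: "(\<lambda>_. 0) \<in> I"
  by (rule rel[OF gw_rel.zero])

lemma diff: "f \<in> I \<Longrightarrow> g \<in> I \<Longrightarrow> (\<lambda>X. f X - g X) \<in> I"
  using add[OF _ neg, of f g] by simp

lemma scale: "f \<in> I \<Longrightarrow> (\<lambda>X. n * f X) \<in> I"
proof -
  assume f: "f \<in> I"
  have "(\<lambda>X. int m * f X) \<in> I" for m
    by (induction m) (use zero add[OF f] in \<open>auto simp: distrib_right\<close>)
  from this[of "nat n"] neg[OF this[of "nat (- n)"]] show ?thesis
    by (cases "n \<ge> 0") auto
qed

lemma isometric_iff: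
  assumes "qform A" "qform B" "isometric A B"
  shows "delta A \<in> I \<longleftrightarrow> delta B \<in> I"
  using diff[OF _ rel[OF gw_rel.iso[OF assms]], of "delta A"] 
    add[OF rel[OF gw_rel.iso[OF assms]], of "delta B"] by (auto simp: fun_eq_iff)

lemma osum_iff:
  assumes "qform A" "qform B"
  shows "delta (osum A B) \<in> I \<longleftrightarrow> (\<lambda>X. delta A X + delta B X) \<in> I"
  using diff[OF _ rel[OF gw_rel.sum[OF assms]], of "delta (osum A B)"] 
    add[OF rel[OF gw_rel.sum[OF assms]], of "\<lambda>X. delta A X + delta B X"] 
  by (auto simp: algebra_simps)

text \<open>Diagonalisation as a generation statement: by induction on the dimension, a change of
  basis makes the corner nonzero, the corner splits off, and the smaller complement is covered by
  the induction hypothesis.\<close>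

lemma delta_in_if_rank_one:
  assumes two: "(2::'k) \<noteq> 0" and one: "\<And>a. a \<noteq> 0 \<Longrightarrow> delta (rank_one_form a) \<in> I"
    and "qform A"
  shows "delta A \<in> I"
  using assms(3)
proof (induction "dim_row A" arbitrary: A)
  case 0
  then have "A \<in> carrier_mat 0 0" by (simp add: qform_def)
  \<comment> \<open>The empty form is its own double, so the sum relation for it reads
    \<open>- delta A\<close> and puts \<open>delta A\<close> into every such subgroup.\<close>
  then have "osum A A = A" by (auto simp: osum_def intro!: eq_matI)
  with neg[OF rel[OF gw_rel.sum[OF 0(2) 0(2)]]] show ?case by simp
next
  case (Suc n)
  obtain P where P: "P \<in> carrier_mat (Suc n) (Suc n)" "det P \<noteq> 0"
    "(transpose_mat P * A * P) $$ (0, 0) \<noteq> 0"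
    using qform_nonzero_corner[OF two Suc.prems Suc.hyps(2)[symmetric]] by blast
  let ?A = "transpose_mat P * A * P" and ?a = "(transpose_mat P * A * P) $$ (0, 0)"
  have iso1: "isometric A ?A" using P Suc.hyps(2) unfolding isometric_def by auto
  then have q1: "qform ?A" using isometric_qform Suc.prems by blast
  have "dim_row ?A = Suc n" using P by simp
  from qform_split_corner[OF q1 this P(3)] obtain B where
    B: "B \<in> carrier_mat n n" "isometric ?A (osum (rank_one_form ?a) B)" by blast
  from isometric_qform[OF q1 B(2)] have q2: "qform (osum (rank_one_form ?a) B)" .
  then have qB: "qform B" by (rule qform_osumD(2)[of _ _ 1]) (use B(1) in auto)
  have "delta B \<in> I" using Suc.hyps(1)[of B] qB B(1) by auto
  then have "(\<lambda>X. delta (rank_one_form ?a) X + delta B X) \<in> I"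
    using one[OF P(3)] add by blast
  then have "delta (osum (rank_one_form ?a) B) \<in> I"
    using osum_iff[OF qform_rank_one[OF P(3)] qB] by blast
  with isometric_iff[OF q1 q2 B(2)] isometric_iff[OF Suc.prems q1 iso1] show ?case by blast
qed

lemma gw_free_subset:
  assumes "\<And>A. qform A \<Longrightarrow> delta A \<in> I"
  shows "gw_free \<subseteq> I"
proof
  fix f :: "'k mat \<Rightarrow> int" assume f: "f \<in> gw_free"
  let ?S = "{A. f A \<noteq> 0}"
  have fin: "finite ?S" and q: "\<And>A. A \<in> ?S \<Longrightarrow> qform A" using f by (auto simp: gw_free_def)
  have "(\<lambda>X. \<Sum>A\<in>T. f A * delta A X) \<in> I" if "T \<subseteq> ?S" for T
    using finite_subset[OF that fin] that
  proof (induction T rule: finite_induct)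
    case (insert A T)
    then show ?case using add[OF scale[OF assms[OF q]]] by simp
  qed (simp add: zero)
  from this[OF subset_refl] have "(\<lambda>X. \<Sum>A\<in>?S. f A * delta A X) \<in> I" .
  moreover have "(\<lambda>X. \<Sum>A\<in>?S. f A * delta A X) = f"
    using fin by (auto simp: delta_def if_distrib[of "(*) _"] cong: if_cong)
  ultimately show "f \<in> I" by simp
qed

end

section \<open>The determinant as a homomorphism on the free group, well defined modulo squares on
  GW(k)\<close>

definition gw_det :: "('k::field mat \<Rightarrow> int) \<Rightarrow> 'k" where
  "gw_det f = (\<Prod>A | f A \<noteq> 0. det A powi f A)"

lemma gw_det_eq_prod:
  assumes "finite S" "{A. f A \<noteq> 0} \<subseteq> S"
  shows "gw_det f = (\<Prod>A\<in>S. det A powi f A)"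
  unfolding gw_det_def using assms by (intro prod.mono_neutral_left) auto

lemma gw_det_delta [simp]: "gw_det (delta A) = det A"
  by (subst gw_det_eq_prod[of "{A}"]) (auto simp: delta_def)

lemma gw_free_zero: "(\<lambda>_. 0) \<in> gw_free"
  by (simp add: gw_free_def)

lemma gw_free_delta: "qform A \<Longrightarrow> delta A \<in> gw_free"
  by (auto simp: gw_free_def delta_def)

lemma gw_free_add:
  assumes "f \<in> gw_free" "g \<in> gw_free"
  shows "(\<lambda>X. f X + g X) \<in> gw_free"
proof -
  have "{A. f A + g A \<noteq> 0} \<subseteq> {A. f A \<noteq> 0} \<union> {A. g A \<noteq> 0}" by auto
  with assms show ?thesis unfolding gw_free_def by (fastforce dest: finite_subset)
qed

lemma gw_free_neg: "f \<in> gw_free \<Longrightarrow> (\<lambda>X. - f X) \<in> gw_free"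
  by (simp add: gw_free_def)

lemma gw_free_scale: "f \<in> gw_free \<Longrightarrow> (\<lambda>X. n * f X) \<in> gw_free"
  by (cases "n = 0") (auto simp: gw_free_def)

lemma gw_det_nonzero: "f \<in> gw_free \<Longrightarrow> gw_det f \<noteq> 0"
  by (auto simp: gw_free_def gw_det_def qform_def)

lemma gw_det_add:
  assumes "f \<in> gw_free" "g \<in> gw_free"
  shows "gw_det (\<lambda>X. f X + g X) = gw_det f * gw_det g"
proof -
  let ?S = "{A. f A \<noteq> 0} \<union> {A. g A \<noteq> 0}"
  have fin: "finite ?S" using assms by (auto simp: gw_free_def)
  \<comment> \<open>Adding exponents in \<open>powi\<close> is only valid for a nonzero base when
    signs differ, so nondegeneracy enters here.\<close>
  have nz: "det A \<noteq> 0" if "A \<in> ?S" for A using assms that by (auto simp: gw_free_def qform_def)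
  have "gw_det (\<lambda>X. f X + g X) = (\<Prod>A\<in>?S. det A powi (f A + g A))"
    using fin by (intro gw_det_eq_prod) auto
  also have "\<dots> = (\<Prod>A\<in>?S. det A powi f A * det A powi g A)"
    using nz by (intro prod.cong) (auto simp: power_int_add)
  also have "\<dots> = gw_det f * gw_det g"
    using fin by (simp add: prod.distrib gw_det_eq_prod[of ?S f] gw_det_eq_prod[of ?S g])
  finally show ?thesis .
qed

lemma gw_det_neg: "gw_det (\<lambda>X. - f X) = inverse (gw_det f)"
  by (simp add: gw_det_def power_int_minus flip: prod_inversef)

lemma gw_det_diff:
  assumes "f \<in> gw_free" "g \<in> gw_free"
  shows "gw_det (\<lambda>X. f X - g X) = gw_det f / gw_det g"
  using gw_det_add[OF assms(1) gw_free_neg[OF assms(2)]] by (simp add: gw_det_neg field_simps)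

lemma gw_free_diff:
  assumes "f \<in> gw_free" "g \<in> gw_free"
  shows "(\<lambda>X. f X - g X) \<in> gw_free"
  using gw_free_add[OF assms(1) gw_free_neg[OF assms(2)]] by simp

text \<open>Congruence by P multiplies the determinant by (det P)^2, orthogonal sums multiply
  determinants, and squares are closed under products and inverses. Membership in
  \<open>gw_free\<close> is carried along because multiplicativity of \<open>gw_det\<close> needs
  finite support and nonzero determinants.\<close>

lemma gw_rel_det: "f \<in> gw_rel \<Longrightarrow> f \<in> gw_free \<and> (\<exists>y. gw_det f = y\<^sup>2)"
proof (induction rule: gw_rel.induct)
  case zero
  show ?case by (auto simp: gw_free_zero gw_det_def intro: exI[of _ 1])
next
  case (iso A B)
  note d = gw_free_delta[OF iso(1)] gw_free_delta[OF iso(2)]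
  obtain P where P: "P \<in> carrier_mat (dim_row A) (dim_row A)" "det P \<noteq> 0"
    "transpose_mat P * A * P = B" using iso(3) by (auto simp: isometric_def)
  have "det B = (det P)\<^sup>2 * det A"
    using det_congruence[OF _ P(1), of A] P(3) iso(1) unfolding qform_def by simp
  moreover have "det A \<noteq> 0" using iso(1) by (simp add: qform_def)
  ultimately have "gw_det (\<lambda>X. delta A X - delta B X) = (inverse (det P))\<^sup>2"
    using P(2) by (simp add: gw_det_diff[OF d] field_simps)
  with gw_free_diff[OF d] show ?case by blast
next
  case (sum A B)
  note d = gw_free_delta[OF sum(1)] gw_free_delta[OF sum(2)] 
    gw_free_delta[OF qform_osum[OF sum]]
  have "gw_det (\<lambda>X. delta (osum A B) X - delta A X - delta B X) = det (osum A B) / det A / det B"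
    using d by (simp add: gw_det_diff gw_free_diff)
  also have "\<dots> = 1\<^sup>2"
    using sum det_osum[of A "dim_row A" B "dim_row B"] unfolding qform_def by simp
  finally show ?case using gw_free_diff[OF gw_free_diff[OF d(3,1)] d(2)] by blast
next
  case (add f g)
  then show ?case by (metis gw_free_add gw_det_add power_mult_distrib)
next
  case (neg f)
  then show ?case by (metis gw_free_neg gw_det_neg power_inverse)
qed

subsection \<open>Trace forms of intermediate fields\<close>

text \<open>Zero rows are added to make the matrix square. Row \<open>n\<close> of the result is
  zero, so the transpose kills the unit vector with index \<open>n\<close>; the determinant is
  therefore 0 and the padded matrix has a kernel vector too.\<close>

lemma wide_mat_kernel:
  assumes "(A :: 'a::idom mat) \<in> carrier_mat n m" "n < m"
  obtains v where "v \<in> carrier_vec m" "v \<noteq> 0\<^sub>v m" "A *\<^sub>v v = 0\<^sub>v n"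
proof -
  define B where "B = mat m m (\<lambda>(i, j). if i < n then A $$ (i, j) else 0)"
  have B: "B \<in> carrier_mat m m" by (simp add: B_def)
  have "transpose_mat B *\<^sub>v unit_vec m n = 0\<^sub>v m"
    using assms B by (intro eq_vecI) (auto simp: B_def)
  moreover have "unit_vec m n \<noteq> (0\<^sub>v m :: 'a vec)"
    using assms(2) by (metis index_unit_vec(2) index_zero_vec(1) zero_neq_one)
  ultimately have "det (transpose_mat B) = 0"
    using B by (subst det_0_iff_vec_prod_zero[of _ m]) (auto intro!: exI[of _ "unit_vec m n"])
  then have "det B = 0" using det_transpose[OF B] by simp
  then obtain v where v: "v \<in> carrier_vec m" "v \<noteq> 0\<^sub>v m" "B *\<^sub>v v = 0\<^sub>v m"
    using det_0_iff_vec_prod_zero[OF B] by blast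
  have "A *\<^sub>v v = 0\<^sub>v n"
  proof (rule eq_vecI)
    fix i assume "i < dim_vec (0\<^sub>v n :: 'a vec)"
    then have i: "i < n" by simp
    then have "row A i = row B i"
      using assms by (intro eq_vecI) (auto simp: B_def)
    moreover have "(B *\<^sub>v v) $ i = 0" using v(3) i assms(2) by simp
    ultimately show "(A *\<^sub>v v) $ i = 0\<^sub>v n $ i" using i assms B by simp
  qed (use assms in simp)
  with v(1,2) show ?thesis by (rule that)
qed

text \<open>Independence of the characters of the monoid \<open>V\<close>. All functions vanish
  outside \<open>V\<close>, so two distinct ones already differ at some z in \<open>V\<close>.
  Subtracting g z times the relation at x from the relation at z * x eliminates g, and the remaining
  coefficients a h (h z - g z) vanish by induction.\<close>

lemma dedekind_independence:
  fixes F :: "('a::monoid_mult \<Rightarrow> 'b::idom) set"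
  assumes "finite F" "1 \<in> V" "\<And>x y. x \<in> V \<Longrightarrow> y \<in> V \<Longrightarrow> x * y \<in> V"
    and "\<And>f. f \<in> F \<Longrightarrow> f 1 = 1"
    and "\<And>f x y. f \<in> F \<Longrightarrow> x \<in> V \<Longrightarrow> y \<in> V \<Longrightarrow> f (x * y) = f x * f y"
    and "\<And>f x. f \<in> F \<Longrightarrow> x \<notin> V \<Longrightarrow> f x = 0"
    and "\<And>x. x \<in> V \<Longrightarrow> (\<Sum>f\<in>F. a f * f x) = 0" and "f \<in> F"
  shows "a f = 0"
  using assms(1,4-)
proof (induction F arbitrary: a f rule: finite_induct)
  case (insert g F)
  have F0: "a h = 0" if h: "h \<in> F" for h
  proof -
    have "h \<noteq> g" using h insert.hyps by blast
    then obtain z where z: "h z \<noteq> g z" by blast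
    then have zV: "z \<in> V" using insert.prems(3)[of h z] insert.prems(3)[of g z] h
      by (cases "z \<in> V") simp_all
    have "a h * (h z - g z) = 0"
    proof (rule insert.IH[of "\<lambda>h. a h * (h z - g z)" h])
      fix x assume x: "x \<in> V"
      have "(\<Sum>f\<in>F. a f * (f z - g z) * f x) = (\<Sum>f\<in>F. a f * (f (z * x)) - g z * (a f * f x))"
        by (intro sum.cong refl) (simp add: insert.prems(2)[OF _ zV x] algebra_simps)
      also have "\<dots> = (\<Sum>f\<in>F. a f * (f (z * x))) - g z * (\<Sum>f\<in>F. a f * f x)"
        by (simp add: sum_subtractf sum_distrib_left)
      also have "\<dots> = - (a g * g (z * x)) - g z * (- (a g * g x))"
        using insert.prems(4)[OF assms(3)[OF zV x]] insert.prems(4)[OF x] insert.hyps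
        by (simp add: add_eq_0_iff add_eq_0_iff2)
      also have "\<dots> = 0" using insert.prems(2)[of g z x] zV x by simp
      finally show "(\<Sum>f\<in>F. a f * (f z - g z) * f x) = 0" .
    qed (use insert.prems h in auto)
    with z show ?thesis by simp
  qed
  \<comment> \<open>All other coefficients are already 0, so evaluating the relation at 1 isolates
    \<open>a g\<close>.\<close>
  have "a g = (\<Sum>f\<in>insert g F. a f * f 1)"
    using insert.hyps F0 insert.prems(1) by simp
  also have "\<dots> = 0" using insert.prems(4)[OF assms(2)] .
  finally show ?case using F0 insert.prems(5) by blast
qed simp

section \<open>The Galois extension, its group, and bases of intermediate rings\<close>

locale finite_galois_extension =
  fixes \<iota> :: "'k::field \<Rightarrow> 'l::field"
  assumes field_hom: "field_hom \<iota>" and finite_galois: "finite_galois \<iota>"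
begin

sublocale hom: Ring_Hom.field_hom \<iota>
proof
  show "\<iota> 0 = 0" using field_hom by (metis add_cancel_left_right add.right_neutral field_hom_def)
qed (use field_hom in \<open>auto simp: field_hom_def\<close>)

abbreviation G :: "('l \<Rightarrow> 'l) set" where "G \<equiv> galois_group \<iota>"

lemma galD:
  assumes "\<sigma> \<in> G"
  shows "bij \<sigma>" "\<sigma> (x + y) = \<sigma> x + \<sigma> y" "\<sigma> (x * y) = \<sigma> x * \<sigma> y" "\<sigma> (\<iota> a) = \<iota> a"
    "\<sigma> 0 = 0" "\<sigma> 1 = 1" "\<sigma> (- x) = - \<sigma> x"
proof -
  show b: "bij \<sigma>" and a: "\<And>x y. \<sigma> (x + y) = \<sigma> x + \<sigma> y" and "\<sigma> (x * y) = \<sigma> x * \<sigma> y"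
    and i: "\<And>a. \<sigma> (\<iota> a) = \<iota> a"
    using assms by (auto simp: galois_group_def)
  show z: "\<sigma> 0 = 0" and "\<sigma> 1 = 1" using i[of 0] i[of 1] by simp_all
  show "\<sigma> (- x) = - \<sigma> x" using a[of x "- x"] z by (simp add: add_eq_0_iff)
qed

lemma gal_sum: "\<sigma> \<in> G \<Longrightarrow> \<sigma> (\<Sum>i\<in>A. f i) = (\<Sum>i\<in>A. \<sigma> (f i))"
  by (induction A rule: infinite_finite_induct) (simp_all add: galD)

lemma id_gal: "id \<in> G"
  by (simp add: galois_group_def)

lemma comp_gal: "\<sigma> \<in> G \<Longrightarrow> \<tau> \<in> G \<Longrightarrow> \<sigma> \<circ> \<tau> \<in> G"
  by (auto simp: galois_group_def bij_comp)

lemma inv_gal: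
  assumes "\<sigma> \<in> G"
  shows "inv_into UNIV \<sigma> \<in> G"
proof -
  note b = galD(1)[OF assms]
  have s: "\<sigma> (inv_into UNIV \<sigma> x) = x" for x using b by (simp add: bij_is_surj surj_f_inv_f)
  have i: "inv_into UNIV \<sigma> (\<sigma> x) = x" for x using b by (simp add: bij_is_inj)
  show ?thesis
    unfolding galois_group_def
  proof (intro CollectI conjI allI)
    show "bij (inv_into UNIV \<sigma>)" using b by (rule bij_imp_bij_inv)
    fix x y a
    show "inv_into UNIV \<sigma> (x + y) = inv_into UNIV \<sigma> x + inv_into UNIV \<sigma> y" by (metis galD(2)[OF assms] s i)
    show "inv_into UNIV \<sigma> (x * y) = inv_into UNIV \<sigma> x * inv_into UNIV \<sigma> y" by (metis galD(3)[OF assms] s i)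
    show "inv_into UNIV \<sigma> (\<iota> a) = \<iota> a" by (metis galD(4)[OF assms] i)
  qed
qed

lemma fixed_field_gal: "(\<And>\<sigma>. \<sigma> \<in> G \<Longrightarrow> \<sigma> x = x) \<Longrightarrow> x \<in> range \<iota>"
  using finite_galois by (auto simp: finite_galois_def fixed_field_def)

text \<open>In a finite extension a subring containing the base is a field, and negatives come from
  multiplying by the image of -1; closure under sums and products thus describes exactly the
  intermediate fields.\<close>

definition intermediate :: "'l set \<Rightarrow> bool" where
  "intermediate V \<longleftrightarrow> range \<iota> \<subseteq> V \<and> (\<forall>x\<in>V. \<forall>y\<in>V. x + y \<in> V \<and> x * y \<in> V)"

lemma intermediateD:
  assumes "intermediate V"
  shows "\<iota> a \<in> V" "0 \<in> V" "1 \<in> V" "x \<in> V \<Longrightarrow> y \<in> V \<Longrightarrow> x + y \<in> V" "x \<in> V \<Longrightarrow> y \<in> V \<Longrightarrow> x * y \<in> V"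
proof -
  show i: "\<And>a. \<iota> a \<in> V" using assms by (auto simp: intermediate_def)
  show "0 \<in> V" "1 \<in> V" using i[of 0] i[of 1] by simp_all
qed (use assms in \<open>auto simp: intermediate_def\<close>)

lemma intermediate_UNIV: "intermediate UNIV"
  by (simp add: intermediate_def)

lemma intermediate_fixed_field: "H \<subseteq> G \<Longrightarrow> intermediate (fixed_field H)"
  by (auto simp: intermediate_def fixed_field_def galD subset_iff)

lemma kbasis_indep:
  assumes "kbasis \<iota> V e m" "0 \<in> V" "(\<Sum>i<m. \<iota> (c i) * e i) = 0" "i < m"
  shows "c i = 0"
proof -
  define P where "P c \<longleftrightarrow> (\<forall>i\<ge>m. c i = 0) \<and> 0 = (\<Sum>i<m. \<iota> (c i) * e i)" for c
  \<comment> \<open>Uniqueness in \<open>kbasis\<close> concerns coefficient functions that vanish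
    from \<open>m\<close> on, so \<open>c\<close> is cut off there before it is compared with
    0.\<close>
  define c' where "c' = (\<lambda>i. if i < m then c i else 0)"
  have "\<exists>!c. P c" using assms(1,2) unfolding kbasis_def P_def by blast
  moreover have "P c'" using assms(3) by (simp add: P_def c'_def)
  moreover have "P (\<lambda>_. 0)" by (simp add: P_def)
  ultimately have "c' = (\<lambda>_. 0)" by blast
  from fun_cong[OF this, of i] assms(4) show ?thesis by (simp add: c'_def)
qed

lemma kcoord_sum:
  assumes "kbasis \<iota> V e m" "x \<in> V"
  shows "x = (\<Sum>i<m. \<iota> (kcoord \<iota> e m x i) * e i)"
proof -
  have "\<exists>!c. (\<forall>i\<ge>m. c i = 0) \<and> x = (\<Sum>i<m. \<iota> (c i) * e i)"
    using assms by (simp add: kbasis_def)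
  from theI'[OF this] show ?thesis unfolding kcoord_def by blast
qed

lemma kbasis_mem: "kbasis \<iota> V e m \<Longrightarrow> i < m \<Longrightarrow> e i \<in> V"
  by (simp add: kbasis_def)

lemma kbasisI:
  assumes "\<And>i. i < m \<Longrightarrow> e i \<in> V" "\<And>x. x \<in> V \<Longrightarrow> \<exists>c. x = (\<Sum>i<m. \<iota> (c i) * e i)"
    and indep: "\<And>c i. (\<Sum>i<m. \<iota> (c i) * e i) = 0 \<Longrightarrow> i < m \<Longrightarrow> c i = 0"
  shows "kbasis \<iota> V e m"
  unfolding kbasis_def
proof (intro conjI allI impI ballI)
  fix x assume "x \<in> V"
  then obtain c where c: "x = (\<Sum>i<m. \<iota> (c i) * e i)" using assms(2) by blast
  show "\<exists>!c. (\<forall>i\<ge>m. c i = 0) \<and> x = (\<Sum>i<m. \<iota> (c i) * e i)"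
  proof (rule ex1I[of _ "\<lambda>i. if i < m then c i else 0"])
    fix d assume d: "(\<forall>i\<ge>m. d i = 0) \<and> x = (\<Sum>i<m. \<iota> (d i) * e i)"
    have "(\<Sum>i<m. \<iota> (d i - c i) * e i) = x - x"
      using c d by (simp add: hom.hom_minus left_diff_distrib sum_subtractf)
    then have "d i - c i = 0" if "i < m" for i using indep[of "\<lambda>i. d i - c i"] that by simp
    then show "d = (\<lambda>i. if i < m then c i else 0)" using d by (auto simp: not_less)
  qed (use c in auto)
qed (use assms(1) in blast)

text \<open>This justifies the choice made in \<open>chosen_basis\<close>. A maximal independent
  subset of \<open>V\<close> spans \<open>V\<close>, and it is finite because finitely many elements
  span L over k.\<close>

lemma intermediate_kbasis:
  assumes "intermediate V"
  shows "\<exists>e m. kbasis \<iota> V e m"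
proof -
  interpret vs: vector_space "\<lambda>c x. \<iota> c * x"
    by unfold_locales (auto simp: algebra_simps hom.hom_add hom.hom_mult)
  obtain e m where e: "kbasis \<iota> UNIV e m" using finite_galois by (auto simp: finite_galois_def)
  have "x \<in> vs.span (e ` {..<m})" for x
    by (subst kcoord_sum[OF e UNIV_I, of x]) (intro vs.span_sum vs.span_scale vs.span_base imageI)
  then have span: "S \<subseteq> vs.span (e ` {..<m})" for S by blast
  obtain B where B: "B \<subseteq> V" "vs.independent B" "V \<subseteq> vs.span B"
    by (rule vs.maximal_independent_subset)
  have fin: "finite B" using vs.independent_span_bound[OF _ B(2) span] by simp
  obtain b where b: "bij_betw b {..<card B} B"
    using ex_bij_betw_nat_finite[OF fin] by (auto simp: atLeast0LessThan)
  have re: "(\<Sum>v\<in>B. g v) = (\<Sum>i<card B. g (b i))" for g :: "'l \<Rightarrow> 'l"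
    using sum.reindex_bij_betw[OF b, of g] by simp
  have "kbasis \<iota> V b (card B)"
  proof (rule kbasisI)
    fix i assume "i < card B"
    then show "b i \<in> V" using b B(1) by (auto simp: bij_betw_def)
  next
    fix x assume "x \<in> V"
    then obtain u where "x = (\<Sum>v\<in>B. \<iota> (u v) * v)"
      using B(3) vs.span_finite[OF fin] by auto
    then show "\<exists>c. x = (\<Sum>i<card B. \<iota> (c i) * b i)" unfolding re by (intro exI[of _ "\<lambda>i. u (b i)"])
  next
    fix c i assume c: "(\<Sum>i<card B. \<iota> (c i) * b i) = 0" and i: "i < card B"
    define u where "u = (\<lambda>v. c (inv_into {..<card B} b v))"
    have u: "u (b j) = c j" if "j < card B" for j
      using that b by (simp add: u_def bij_betw_def)
    have "(\<Sum>v\<in>B. \<iota> (u v) * v) = 0" unfolding re using c u by simp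
    then have "u (b i) = 0"
      using B(2) vs.dependent_finite[OF fin] b i by (auto simp: bij_betw_def)
    with u i show "c i = 0" by simp
  qed
  then show ?thesis by blast
qed

lemma chosen_basis:
  assumes "intermediate V" "chosen_basis \<iota> V = (e, m)"
  shows "kbasis \<iota> V e m"
proof -
  have "\<exists>p. case p of (e, m) \<Rightarrow> kbasis \<iota> V e m" using intermediate_kbasis[OF assms(1)] by auto
  from someI_ex[OF this] show ?thesis using assms(2) unfolding chosen_basis_def by simp
qed

section \<open>Embeddings of an intermediate field and their matrix on a basis\<close>

text \<open>Values outside \<open>V\<close> are normalised to 0, so that embeddings that agree on \<open>V\<close> are equal.\<close>

definition embedding :: "'l set \<Rightarrow> ('l \<Rightarrow> 'l) \<Rightarrow> bool" where
  "embedding V f \<longleftrightarrow> (\<forall>x. x \<notin> V \<longrightarrow> f x = 0) \<and> (\<forall>a. f (\<iota> a) = \<iota> a) \<and>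
     (\<forall>x\<in>V. \<forall>y\<in>V. f (x + y) = f x + f y \<and> f (x * y) = f x * f y)"

lemma embedding_sum:
  fixes m :: nat
  assumes V: "intermediate V" and f: "embedding V f" and e: "\<And>i. i < m \<Longrightarrow> e i \<in> V"
  shows "f (\<Sum>i<m. \<iota> (c i) * e i) = (\<Sum>i<m. \<iota> (c i) * f (e i))"
proof -
  \<comment> \<open>Membership of the partial sums in \<open>V\<close> is part of the induction,
    since \<open>f\<close> is additive only on \<open>V\<close>.\<close>
  have "(\<Sum>i<m. \<iota> (c i) * e i) \<in> V \<and> f (\<Sum>i<m. \<iota> (c i) * e i) = (\<Sum>i<m. \<iota> (c i) * f (e i))"
    using e
  proof (induction m)
    case 0
    have "f (\<iota> 0) = \<iota> 0" using f by (simp only: embedding_def)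
    with V show ?case by (simp add: intermediateD)
  next
    case (Suc m)
    then show ?case using f V by (auto simp: embedding_def intermediateD)
  qed
  then show ?thesis ..
qed

text \<open>A kernel vector is a linear relation between the embeddings that holds on a basis, hence
  on all of \<open>V\<close> because its elements are k-combinations of the basis. Dedekind
  independence then makes it trivial.\<close>

lemma embedding_matrix_rows_indep:
  assumes V: "intermediate V" and e: "kbasis \<iota> V e m" and f: "\<And>s. s < n \<Longrightarrow> embedding V (f s)"
    and inj: "inj_on f {..<n}" and v: "v \<in> carrier_vec n"
    and ker: "mat m n (\<lambda>(j, s). f s (e j)) *\<^sub>v v = 0\<^sub>v m"
  shows "v = 0\<^sub>v n"
proof -
  have ker: "(\<Sum>s<n. f s (e j) * v $ s) = 0" if "j < m" for j
    using arg_cong[OF ker, of "\<lambda>w. w $ j"] that v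
    by (simp add: scalar_prod_def atLeast0LessThan)
  \<comment> \<open>Dedekind's lemma speaks of a set of functions, so the coefficients are reindexed
    by the embeddings themselves; this is where injectivity of \<open>f\<close> is used.\<close>
  define a where "a = (\<lambda>g. v $ inv_into {..<n} f g)"
  have a: "a (f s) = v $ s" if "s < n" for s using that inj by (simp add: a_def)
  have "a g = 0" if g: "g \<in> f ` {..<n}" for g
  proof (rule dedekind_independence[of "f ` {..<n}" V a g])
    fix x assume x: "x \<in> V"
    let ?c = "kcoord \<iota> e m x"
    have fx: "f s x = (\<Sum>j<m. \<iota> (?c j) * f s (e j))" if "s < n" for s
      by (subst (1) kcoord_sum[OF e x]) (rule embedding_sum[OF V f[OF that] kbasis_mem[OF e]])
    have "(\<Sum>g\<in>f ` {..<n}. a g * g x) = (\<Sum>s<n. v $ s * f s x)"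
      using inj a by (simp add: sum.reindex)
    also have "\<dots> = (\<Sum>s<n. \<Sum>j<m. \<iota> (?c j) * (f s (e j) * v $ s))"
      by (intro sum.cong refl) (simp add: fx sum_distrib_left mult_ac)
    also have "\<dots> = (\<Sum>j<m. \<iota> (?c j) * (\<Sum>s<n. f s (e j) * v $ s))"
      by (subst sum.swap) (simp add: sum_distrib_left)
    also have "\<dots> = 0" using ker by simp
    finally show "(\<Sum>g\<in>f ` {..<n}. a g * g x) = 0" .
  next
    fix g assume "g \<in> f ` {..<n}"
    then have "embedding V g" using f by auto
    then have "g (\<iota> 1) = \<iota> 1" by (simp only: embedding_def)
    then show "g 1 = 1" by simp
  qed (use V f g in \<open>auto simp: intermediateD embedding_def\<close>)
  then have "v $ s = 0" if "s < n" for s using a[OF that] that by simp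
  then show ?thesis using v by (intro eq_vecI) auto
qed

lemma card_embeddings_le:
  assumes V: "intermediate V" and e: "kbasis \<iota> V e m" and f: "\<And>s. s < n \<Longrightarrow> embedding V (f s)"
    and inj: "inj_on f {..<n}"
  shows "n \<le> m"
proof (rule ccontr)
  assume "\<not> n \<le> m"
  then have "m < n" by simp
  from wide_mat_kernel[OF mat_carrier this, of "\<lambda>(j, s). f s (e j)"] show False
    using embedding_matrix_rows_indep[OF assms] by blast
qed

definition gal_restrict :: "'l set \<Rightarrow> ('l \<Rightarrow> 'l) \<Rightarrow> 'l \<Rightarrow> 'l" where
  "gal_restrict V \<sigma> = (\<lambda>x. if x \<in> V then \<sigma> x else 0)"

lemma embedding_gal_restrict: "intermediate V \<Longrightarrow> \<sigma> \<in> G \<Longrightarrow> embedding V (gal_restrict V \<sigma>)"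
  by (auto simp: embedding_def gal_restrict_def intermediateD galD)

text \<open>Any m + 1 automorphisms would be m + 1 distinct embeddings of L, more than its degree m
  allows.\<close>

lemma finite_gal: "finite G"
proof (rule ccontr)
  obtain e m where e: "kbasis \<iota> UNIV e m" using finite_galois by (auto simp: finite_galois_def)
  assume "infinite G"
  then obtain F where F: "F \<subseteq> G" "finite F" "card F = Suc m"
    by (rule infinite_arbitrarily_large[THEN exE]) blast
  obtain f where f: "bij_betw f {..<Suc m} F"
    using ex_bij_betw_nat_finite[OF F(2)] F(3) by (auto simp: atLeast0LessThan)
  have "embedding UNIV (f s)" if "s < Suc m" for s
  proof -
    have "f s \<in> G" using that f F(1) by (auto simp: bij_betw_def)
    from embedding_gal_restrict[OF intermediate_UNIV this] show ?thesis by (simp add: gal_restrict_def)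
  qed
  from card_embeddings_le[OF intermediate_UNIV e this, of "Suc m"] show False
    using f by (auto simp: bij_betw_def)
qed

lemma gal_trace_in_base: "(\<Sum>\<sigma>\<in>G. \<sigma> x) \<in> range \<iota>"
proof (rule fixed_field_gal)
  fix \<tau> assume t: "\<tau> \<in> G"
  \<comment> \<open>Composition with \<tau> permutes the group, so \<tau> only rearranges the
    summands of the trace.\<close>
  have "bij_betw ((\<circ>) \<tau>) G G"
  proof (rule bij_betwI)
    show "(\<circ>) \<tau> \<in> G \<rightarrow> G" "(\<circ>) (inv_into UNIV \<tau>) \<in> G \<rightarrow> G" using t comp_gal inv_gal by blast+
    show "inv_into UNIV \<tau> \<circ> (\<tau> \<circ> \<sigma>) = \<sigma>" "\<tau> \<circ> (inv_into UNIV \<tau> \<circ> \<sigma>) = \<sigma>" for \<sigma> :: "'l \<Rightarrow> 'l"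
      using galD(1)[OF t] by (auto simp: fun_eq_iff bij_is_inj bij_is_surj surj_f_inv_f)
  qed
  from sum.reindex_bij_betw[OF this, of "\<lambda>\<sigma>. \<sigma> x"]
  show "\<tau> (\<Sum>\<sigma>\<in>G. \<sigma> x) = (\<Sum>\<sigma>\<in>G. \<sigma> x)" by (simp add: gal_sum[OF t])
qed

text \<open>A vanishing trace would be a Dedekind relation with all coefficients equal to 1.\<close>

lemma gal_trace_nonzero: "\<exists>x. (\<Sum>\<sigma>\<in>G. \<sigma> x) \<noteq> 0"
proof (rule ccontr)
  assume "\<not> ?thesis"
  then have "(1::'l) = 0"
    using dedekind_independence[of G UNIV "\<lambda>_. 1" id] by (simp add: finite_gal galD id_gal)
  then show False by simp
qed

text \<open>Artin's argument: a linear relation between the columns is moved to \<open>k\<close> by the Galois trace,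
  which is not identically zero.\<close>

lemma embedding_matrix_cols_indep:
  assumes V: "intermediate V" and e: "kbasis \<iota> V e m"
    and f: "f ` {..<n} = gal_restrict V ` G" and v: "v \<in> carrier_vec m"
    and ker: "mat n m (\<lambda>(s, j). f s (e j)) *\<^sub>v v = 0\<^sub>v n"
  shows "v = 0\<^sub>v m"
proof -
  have ker: "(\<Sum>j<m. \<sigma> (e j) * v $ j) = 0" if s: "\<sigma> \<in> G" for \<sigma>
  proof -
    have "gal_restrict V \<sigma> \<in> f ` {..<n}" unfolding f using s by (rule imageI)
    then obtain s where s: "s < n" "gal_restrict V \<sigma> = f s" by auto
    have "(\<Sum>j<m. f s (e j) * v $ j) = 0"
      using arg_cong[OF ker, of "\<lambda>w. w $ s"] s(1) v by (simp add: scalar_prod_def atLeast0LessThan)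
    then show ?thesis
      unfolding s(2)[symmetric] using kbasis_mem[OF e] by (simp add: gal_restrict_def)
  qed
  have "v $ i = 0" if i: "i < m" for i
  proof (rule ccontr)
    assume vi: "v $ i \<noteq> 0"
    obtain z where z: "(\<Sum>\<sigma>\<in>G. \<sigma> z) \<noteq> 0" using gal_trace_nonzero by blast
    \<comment> \<open>The scaling makes \<open>w i\<close> equal to \<open>z\<close>, so the
      coefficient at \<open>i\<close> keeps a nonzero Galois trace.\<close>
    define w where "w = (\<lambda>j. z / v $ i * v $ j)"
    have rel: "(\<Sum>j<m. \<sigma> (w j) * e j) = 0" if s: "\<sigma> \<in> G" for \<sigma>
    proof -
      \<comment> \<open>Pulling \<sigma> out of the product turns the sum into \<sigma> applied to a
        multiple of the kernel relation for its inverse.\<close>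
      have "\<sigma> (w j) * e j = \<sigma> (w j * inv_into UNIV \<sigma> (e j))" for j
        using galD(1)[OF s] by (simp add: galD(3)[OF s] bij_is_surj surj_f_inv_f)
      then have "(\<Sum>j<m. \<sigma> (w j) * e j) = (\<Sum>j<m. \<sigma> (z / v $ i * (inv_into UNIV \<sigma> (e j) * v $ j)))"
        by (simp add: w_def mult_ac)
      also have "\<dots> = \<sigma> (z / v $ i * (\<Sum>j<m. inv_into UNIV \<sigma> (e j) * v $ j))"
        by (simp only: gal_sum[OF s, symmetric] sum_distrib_left)
      also have "\<dots> = 0" using ker[OF inv_gal[OF s]] s by (simp add: galD)
      finally show ?thesis .
    qed
    have "\<exists>c. (\<Sum>\<sigma>\<in>G. \<sigma> (w j)) = \<iota> c" for j using gal_trace_in_base[of "w j"] by (auto elim: rangeE)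
    then obtain c where c: "\<And>j. (\<Sum>\<sigma>\<in>G. \<sigma> (w j)) = \<iota> (c j)" by metis
    \<comment> \<open>Summing the relations over the group replaces the coefficients by their Galois
      traces, which lie in k.\<close>
    have "(\<Sum>j<m. \<iota> (c j) * e j) = (\<Sum>\<sigma>\<in>G. \<Sum>j<m. \<sigma> (w j) * e j)"
      unfolding c[symmetric] sum_distrib_right by (rule sum.swap)
    also have "\<dots> = 0" using rel by simp
    finally have "c i = 0" by (rule kbasis_indep[OF e intermediateD(2)[OF V] _ i])
    with c[of i] z vi show False by (simp add: w_def)
  qed
  then show ?thesis using v by (intro eq_vecI) auto
qed

text \<open>The independence of rows and of columns squeezes the number of distinct restrictions of
  the group to \<open>V\<close> to exactly the degree \<open>m\<close>. The matrix is then square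
  with trivial kernel.\<close>

lemma embedding_matrix:
  assumes V: "intermediate V" and e: "kbasis \<iota> V e m"
  obtains f where "bij_betw f {..<m} (gal_restrict V ` G)" "det (mat m m (\<lambda>(s, j). f s (e j))) \<noteq> 0"
proof -
  let ?n = "card (gal_restrict V ` G)"
  obtain f where f: "bij_betw f {..<?n} (gal_restrict V ` G)"
    using ex_bij_betw_nat_finite[of "gal_restrict V ` G"] finite_gal by (auto simp: atLeast0LessThan)
  have im: "f ` {..<?n} = gal_restrict V ` G" and inj: "inj_on f {..<?n}"
    using f by (auto simp: bij_betw_def)
  have emb: "embedding V (f s)" if "s < ?n" for s
  proof -
    have "f s \<in> gal_restrict V ` G" using im that by blast
    then obtain \<sigma> where "\<sigma> \<in> G" "f s = gal_restrict V \<sigma>" by blast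
    then show ?thesis using embedding_gal_restrict[OF V] by simp
  qed
  have "?n \<le> m" by (rule card_embeddings_le[OF V e emb inj])
  moreover have "\<not> ?n < m"
    using wide_mat_kernel[OF mat_carrier, of ?n m "\<lambda>(s, j). f s (e j)"]
      embedding_matrix_cols_indep[OF V e im] by blast
  ultimately have n: "?n = m" by simp
  let ?M = "mat m m (\<lambda>(s, j). f s (e j))"
  have "det ?M \<noteq> 0"
    using embedding_matrix_cols_indep[OF V e im, unfolded n] det_0_iff_vec_prod_zero[OF mat_carrier]
    by blast
  with f n show ?thesis by (intro that[of f]) auto
qed

section \<open>Traces and trace forms as sums over embeddings\<close>

text \<open>With \<open>M = (f s (e j))\<close>, multiplication by \<open>y\<close> has matrix \<open>C\<close> where
  \<open>diag (f s y) * M = M * C\<close>.\<close>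

lemma ktrace_eq:
  assumes V: "intermediate V" and y: "y \<in> V"
  shows "\<iota> (ktrace \<iota> V y) = (\<Sum>f\<in>gal_restrict V ` G. f y)"
proof -
  obtain e m where em: "chosen_basis \<iota> V = (e, m)" by (cases "chosen_basis \<iota> V")
  note e = chosen_basis[OF V em]
  obtain f where f: "bij_betw f {..<m} (gal_restrict V ` G)"
    and d: "det (mat m m (\<lambda>(s, j). f s (e j))) \<noteq> 0"
    using embedding_matrix[OF V e] by blast
  let ?M = "mat m m (\<lambda>(s, j). f s (e j))"
  have emb: "embedding V (f s)" if "s < m" for s
  proof -
    have "f s \<in> gal_restrict V ` G" using f that by (auto simp: bij_betw_def)
    then obtain \<sigma> where "\<sigma> \<in> G" "f s = gal_restrict V \<sigma>" by blast
    then show ?thesis using embedding_gal_restrict[OF V] by simp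
  qed
  obtain N where N: "N \<in> carrier_mat m m" "?M * N = 1\<^sub>m m" "N * ?M = 1\<^sub>m m"
    using det_non_zero_imp_unit[OF mat_carrier d, of "()"]
    by (auto simp: Units_def ring_mat_def)
  have MN: "(\<Sum>j<m. f s (e j) * N $$ (j, s)) = 1" if "s < m" for s
    using arg_cong[OF N(2), of "\<lambda>A. A $$ (s, s)"] that N(1) by (simp add: scalar_prod_def atLeast0LessThan)
  have NM: "(\<Sum>s<m. N $$ (i, s) * f s (e j)) = (if i = j then 1 else 0)" if "i < m" "j < m" for i j
    using arg_cong[OF N(3), of "\<lambda>A. A $$ (i, j)"] that N(1) by (simp add: scalar_prod_def atLeast0LessThan)
  define C where "C = (\<lambda>i j. kcoord \<iota> e m (y * e j) i)"
  have C: "f s y * f s (e j) = (\<Sum>i<m. \<iota> (C i j) * f s (e i))" if "s < m" "j < m" for s j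
  proof -
    have ej: "e j \<in> V" using kbasis_mem[OF e that(2)] .
    have "f s y * f s (e j) = f s (y * e j)" using emb[OF that(1)] y ej by (simp add: embedding_def)
    also have "\<dots> = (\<Sum>i<m. \<iota> (C i j) * f s (e i))"
      by (subst kcoord_sum[OF e intermediateD(5)[OF V y ej]])
        (simp add: embedding_sum[OF V emb[OF that(1)] kbasis_mem[OF e]] C_def)
    finally show ?thesis .
  qed
  have "\<iota> (C j j) = (\<Sum>s<m. N $$ (j, s) * (f s y * f s (e j)))" if j: "j < m" for j
  proof -
    have "(\<Sum>s<m. N $$ (j, s) * (f s y * f s (e j)))
      = (\<Sum>s<m. \<Sum>i<m. \<iota> (C i j) * (N $$ (j, s) * f s (e i)))"
      using C j by (simp add: sum_distrib_left mult_ac)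
    also have "\<dots> = (\<Sum>i<m. \<iota> (C i j) * (\<Sum>s<m. N $$ (j, s) * f s (e i)))"
      by (subst sum.swap) (simp add: sum_distrib_left)
    also have "\<dots> = (\<Sum>i<m. if j = i then \<iota> (C i j) else 0)"
      using NM j by (intro sum.cong) auto
    also have "\<dots> = \<iota> (C j j)" using j by simp
    finally show ?thesis ..
  qed
  then have "\<iota> (ktrace \<iota> V y) = (\<Sum>j<m. \<Sum>s<m. N $$ (j, s) * (f s y * f s (e j)))"
    by (simp add: ktrace_def em C_def hom.hom_sum)
  \<comment> \<open>Cyclicity of the trace: tr(N D M) = tr(D M N) = tr(D), with D the diagonal
    matrix of the \<open>f s y\<close> and N the inverse of M.\<close>
  also have "\<dots> = (\<Sum>s<m. f s y * (\<Sum>j<m. f s (e j) * N $$ (j, s)))"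
    by (subst sum.swap) (simp add: sum_distrib_left mult_ac)
  also have "\<dots> = (\<Sum>s<m. f s y)" using MN by simp
  also have "\<dots> = (\<Sum>f\<in>gal_restrict V ` G. f y)" using sum.reindex_bij_betw[OF f, of "\<lambda>f. f y"] .
  finally show ?thesis .
qed

text \<open>Since the trace is the sum over the embeddings, the Gram matrix becomes M^T M over L,
  with M the embedding matrix. Invertibility of M gives nondegeneracy, and det M is the square
  root.\<close>

lemma trace_form_sqrt_det:
  assumes V: "intermediate V"
  shows "qform (trace_form \<iota> V)" "\<exists>y. \<iota> (det (trace_form \<iota> V)) = y\<^sup>2"
proof -
  obtain e m where em: "chosen_basis \<iota> V = (e, m)" by (cases "chosen_basis \<iota> V")
  note e = chosen_basis[OF V em]
  obtain f where f: "bij_betw f {..<m} (gal_restrict V ` G)"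
    and d: "det (mat m m (\<lambda>(s, j). f s (e j))) \<noteq> 0"
    using embedding_matrix[OF V e] by blast
  let ?M = "mat m m (\<lambda>(s, j). f s (e j))"
  have emb: "embedding V (f s)" if "s < m" for s
  proof -
    have "f s \<in> gal_restrict V ` G" using f that by (auto simp: bij_betw_def)
    then obtain \<sigma> where "\<sigma> \<in> G" "f s = gal_restrict V \<sigma>" by blast
    then show ?thesis using embedding_gal_restrict[OF V] by simp
  qed
  have T: "trace_form \<iota> V = mat m m (\<lambda>(i, j). ktrace \<iota> V (e i * e j))"
    by (simp add: trace_form_def em)
  have eV: "e j \<in> V" if "j < m" for j using kbasis_mem[OF e that] .
  have "\<iota> (ktrace \<iota> V (e i * e j)) = (\<Sum>s<m. f s (e i) * f s (e j))" if "i < m" "j < m" for i j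
  proof -
    have "\<iota> (ktrace \<iota> V (e i * e j)) = (\<Sum>s<m. f s (e i * e j))"
      using ktrace_eq[OF V intermediateD(5)[OF V eV eV]] that
        sum.reindex_bij_betw[OF f, of "\<lambda>f. f (e i * e j)"] by simp
    also have "\<dots> = (\<Sum>s<m. f s (e i) * f s (e j))"
      using emb eV that by (intro sum.cong) (auto simp: embedding_def)
    finally show ?thesis .
  qed
  then have "map_mat \<iota> (trace_form \<iota> V) = transpose_mat ?M * ?M"
    unfolding T by (intro eq_matI) (auto simp: scalar_prod_def atLeast0LessThan)
  then have "\<iota> (det (trace_form \<iota> V)) = det (transpose_mat ?M * ?M)"
    by (metis hom.hom_det)
  also have "\<dots> = (det ?M)\<^sup>2"
    by (simp add: det_mult[of _ m] det_transpose[of _ m] power2_eq_square)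
  finally have sq: "\<iota> (det (trace_form \<iota> V)) = (det ?M)\<^sup>2" .
  then show "\<exists>y. \<iota> (det (trace_form \<iota> V)) = y\<^sup>2" by blast
  have "det (trace_form \<iota> V) \<noteq> 0" using sq d by auto
  moreover have "transpose_mat (trace_form \<iota> V) = trace_form \<iota> V"
    unfolding T by (intro eq_matI) (auto simp: mult.commute)
  moreover have "trace_form \<iota> V \<in> carrier_mat m m" by (simp add: T)
  ultimately show "qform (trace_form \<iota> V)" by (simp add: qform_iff)
qed

end

subsection \<open>The image of the Dress map\<close>

text \<open>\<open>A\<close> is not assumed injective: different classes may have the same trace
  form matrix. The determinant is therefore obtained from additivity and not from the support of the
  sum.\<close>

lemma gw_det_sum_delta:
  assumes "finite T" "\<And>i. i \<in> T \<Longrightarrow> qform (A i)"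
  shows "(\<lambda>X. \<Sum>i\<in>T. n i * delta (A i) X) \<in> gw_free \<and>
    gw_det (\<lambda>X. \<Sum>i\<in>T. n i * delta (A i) X) = (\<Prod>i\<in>T. det (A i) powi n i)"
  using assms
proof (induction T rule: finite_induct)
  case empty
  show ?case by (simp add: gw_free_zero gw_det_def)
next
  case (insert i T)
  have free: "(\<lambda>X. n i * delta (A i) X) \<in> gw_free"
    using insert.prems by (intro gw_free_scale gw_free_delta) simp
  have "gw_det (\<lambda>X. n i * delta (A i) X) = det (A i) powi n i"
    by (subst gw_det_eq_prod[of "{A i}"]) (auto simp: delta_def)
  with insert free show ?case
    using gw_free_add[OF free] gw_det_add[OF free] by simp
qed

context finite_galois_extension
begin

lemma finite_conj_classes: "finite (conj_classes \<iota>)"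
proof (rule finite_subset)
  show "conj_classes \<iota> \<subseteq> Pow (Pow G)"
    by (fastforce simp: conj_classes_def conj_class_def gal_subgroup_def intro: comp_gal inv_gal)
qed (simp add: finite_gal)

lemma class_rep_subset:
  assumes "C \<in> conj_classes \<iota>"
  shows "class_rep C \<subseteq> G"
proof -
  obtain H where "C = conj_class \<iota> H" using assms by (auto simp: conj_classes_def)
  \<comment> \<open>Conjugation by the identity shows that the class is nonempty, as the choice in
    \<open>class_rep\<close> requires.\<close>
  then have "(\<lambda>\<tau>. id \<circ> \<tau> \<circ> inv_into UNIV id) ` H \<in> C"
    using id_gal unfolding conj_class_def by blast
  then have "class_rep C \<in> C" unfolding class_rep_def by (rule someI)
  moreover have "C \<subseteq> Pow G"
    using assms by (fastforce simp: conj_classes_def conj_class_def gal_subgroup_def intro: comp_gal inv_gal)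
  ultimately show ?thesis by blast
qed

lemma intermediate_class_rep: "C \<in> conj_classes \<iota> \<Longrightarrow> intermediate (fixed_field (class_rep C))"
  by (intro intermediate_fixed_field class_rep_subset)

lemma hom_power_int: "\<iota> (x powi n) = \<iota> x powi n"
  by (simp add: power_int_def hom.hom_power hom.hom_inverse)

lemma hom_two: "\<iota> 2 = 2"
  using hom.hom_add[of 1 1] by simp

section \<open>Surjectivity forces the elements of k to be squares in L\<close>

lemma dress_det_square: "dress \<iota> c \<in> gw_free \<and> (\<exists>y. \<iota> (gw_det (dress \<iota> c)) = y\<^sup>2)"
proof -
  define T where "T C = trace_form \<iota> (fixed_field (class_rep C))" for C
  have "qform (T C)" if "C \<in> conj_classes \<iota>" for C
    unfolding T_def using trace_form_sqrt_det(1)[OF intermediate_class_rep[OF that]] .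
  from gw_det_sum_delta[OF finite_conj_classes this, where n = c]
  have D: "dress \<iota> c \<in> gw_free" "gw_det (dress \<iota> c) = (\<Prod>C\<in>conj_classes \<iota>. det (T C) powi c C)"
    by (simp_all add: dress_def T_def)
  have "\<exists>y. \<iota> (det (T C)) = y\<^sup>2" if "C \<in> conj_classes \<iota>" for C
    unfolding T_def using trace_form_sqrt_det(2)[OF intermediate_class_rep[OF that]] .
  then obtain y where "\<And>C. C \<in> conj_classes \<iota> \<Longrightarrow> \<iota> (det (T C)) = (y C)\<^sup>2" by metis
  then have "\<iota> (gw_det (dress \<iota> c)) = (\<Prod>C\<in>conj_classes \<iota>. y C powi c C)\<^sup>2"
    unfolding D(2) hom.hom_prod hom_power_int
    by (simp add: power2_eq_square power_int_mult_distrib flip: prod.distrib)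
  with D(1) show ?thesis by blast
qed

text \<open>If <a> equals the image of some \<open>c\<close> in GW(k), then a and the determinant of
  that image differ by a square z^2 of k. The determinant is a square in L, so a is one as
  well.\<close>

lemma square_if_dress_surjective:
  assumes "dress_surjective \<iota>"
  shows "\<exists>y. \<iota> a = y\<^sup>2"
proof (cases "a = 0")
  case True
  then show ?thesis by (intro exI[of _ 0]) simp
next
  case False
  let ?A = "rank_one_form a"
  have A: "delta ?A \<in> gw_free" using False by (intro gw_free_delta qform_rank_one)
  then obtain c where "gw_eq (dress \<iota> c) (delta ?A)"
    using assms by (auto simp: dress_surjective_def)
  then obtain z where z: "gw_det (\<lambda>X. dress \<iota> c X - delta ?A X) = z\<^sup>2"
    using gw_rel_det by (auto simp: gw_eq_def)
  obtain y where y: "\<iota> (gw_det (dress \<iota> c)) = y\<^sup>2" and c: "dress \<iota> c \<in> gw_free"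
    using dress_det_square by blast
  have *: "gw_det (dress \<iota> c) = z\<^sup>2 * a"
    using z False by (simp add: gw_det_diff[OF c A] det_single field_simps del: One_nat_def)
  then have "z \<noteq> 0" using gw_det_nonzero[OF c] by auto
  moreover have "y\<^sup>2 = (\<iota> z)\<^sup>2 * \<iota> a"
    using y unfolding * by (simp add: hom.hom_mult hom.hom_power)
  ultimately have "\<iota> a = (y / \<iota> z)\<^sup>2" by (simp add: field_simps)
  then show ?thesis by blast
qed

text \<open>Being closed under \<open>gw_eq\<close>, this is the full preimage in the free group of
  the image in GW(k). It contains all relations, and surjectivity becomes the inclusion of
  \<open>gw_free\<close>.\<close>

definition dress_image :: "('k mat \<Rightarrow> int) set" where
  "dress_image = {f. \<exists>c\<in>burnside \<iota>. gw_eq (dress \<iota> c) f}"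

lemma dress_add: "dress \<iota> (\<lambda>C. c C + d C) X = dress \<iota> c X + dress \<iota> d X"
  by (simp add: dress_def distrib_right sum.distrib)

lemma dress_neg: "dress \<iota> (\<lambda>C. - c C) X = - dress \<iota> c X"
  by (simp add: dress_def sum_negf)

sublocale dress_image: gw_subgroup dress_image
proof
  fix f g :: "'k mat \<Rightarrow> int" assume "f \<in> dress_image" "g \<in> dress_image"
  then obtain c d where c: "c \<in> burnside \<iota>" "(\<lambda>X. dress \<iota> c X - f X) \<in> gw_rel"
    and d: "d \<in> burnside \<iota>" "(\<lambda>X. dress \<iota> d X - g X) \<in> gw_rel"
    by (auto simp: dress_image_def gw_eq_def)
  have "(\<lambda>C. c C + d C) \<in> burnside \<iota>" using c d by (auto simp: burnside_def)
  moreover have "gw_eq (dress \<iota> (\<lambda>C. c C + d C)) (\<lambda>X. f X + g X)"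
    using gw_rel.add[OF c(2) d(2)] by (simp add: gw_eq_def dress_add algebra_simps)
  ultimately show "(\<lambda>X. f X + g X) \<in> dress_image" by (auto simp: dress_image_def)
next
  fix f :: "'k mat \<Rightarrow> int" assume "f \<in> dress_image"
  then obtain c where c: "c \<in> burnside \<iota>" "(\<lambda>X. dress \<iota> c X - f X) \<in> gw_rel"
    by (auto simp: dress_image_def gw_eq_def)
  have "(\<lambda>C. - c C) \<in> burnside \<iota>" using c by (auto simp: burnside_def)
  moreover have "gw_eq (dress \<iota> (\<lambda>C. - c C)) (\<lambda>X. - f X)"
    using gw_rel.neg[OF c(2)] by (simp add: gw_eq_def dress_neg)
  ultimately show "(\<lambda>X. - f X) \<in> dress_image" by (auto simp: dress_image_def)
next
  fix f :: "'k mat \<Rightarrow> int" assume "f \<in> gw_rel"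
  then have "gw_eq (dress \<iota> (\<lambda>_. 0)) f"
    using gw_rel.neg by (auto simp: gw_eq_def dress_def)
  then show "f \<in> dress_image" by (auto simp: dress_image_def burnside_def)
qed

section \<open>Stabilisers of square roots and the trace forms of k and its quadratic
  extensions\<close>

definition stabiliser :: "'l \<Rightarrow> ('l \<Rightarrow> 'l) set" where
  "stabiliser y = {\<sigma>\<in>G. \<sigma> y = y}"

lemma gal_sqrt:
  assumes "\<sigma> \<in> G" "y\<^sup>2 = \<iota> a"
  shows "\<sigma> y = y \<or> \<sigma> y = - y"
proof -
  have "(\<sigma> y)\<^sup>2 = \<sigma> (y\<^sup>2)" by (simp add: power2_eq_square galD(3)[OF assms(1)])
  then have "(\<sigma> y)\<^sup>2 = y\<^sup>2" by (simp add: assms galD)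
  then show ?thesis by (simp add: power2_eq_iff)
qed

lemma gal_inv_apply:
  assumes "\<sigma> \<in> G"
  shows "\<sigma> (inv_into UNIV \<sigma> x) = x" "inv_into UNIV \<sigma> (\<sigma> x) = x"
  using galD(1)[OF assms] by (simp_all add: bij_is_surj surj_f_inv_f bij_is_inj)

text \<open>Normality of the stabiliser: the inverse of \<sigma> sends y to y or -y, and \<tau>
  fixes both.\<close>

lemma conj_stabiliser:
  assumes "\<sigma> \<in> G" "\<tau> \<in> stabiliser y" "y\<^sup>2 = \<iota> a"
  shows "\<sigma> \<circ> \<tau> \<circ> inv_into UNIV \<sigma> \<in> stabiliser y"
proof -
  have t: "\<tau> \<in> G" "\<tau> y = y" using assms(2) by (auto simp: stabiliser_def)
  have "\<sigma> (inv_into UNIV \<sigma> y) = y" by (rule gal_inv_apply[OF assms(1)])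
  then have "\<sigma> (\<tau> (inv_into UNIV \<sigma> y)) = y"
    using gal_sqrt[OF inv_gal[OF assms(1)] assms(3)] t by (auto simp: galD)
  then show ?thesis using assms(1) t by (simp add: stabiliser_def comp_gal inv_gal)
qed

lemma gal_subgroup_stabiliser: "gal_subgroup \<iota> (stabiliser y)"
  unfolding gal_subgroup_def stabiliser_def
  using id_gal comp_gal inv_gal gal_inv_apply(2) by (auto) (metis gal_inv_apply(2))

text \<open>A normal subgroup is alone in its conjugacy class, which determines the otherwise
  arbitrary \<open>class_rep\<close>.\<close>

lemma conj_class_stabiliser:
  assumes "y\<^sup>2 = \<iota> a"
  shows "conj_class \<iota> (stabiliser y) = {stabiliser y}"
proof -
  have "(\<lambda>\<tau>. \<sigma> \<circ> \<tau> \<circ> inv_into UNIV \<sigma>) ` stabiliser y = stabiliser y" if s: "\<sigma> \<in> G" for \<sigma>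
  proof
    show "(\<lambda>\<tau>. \<sigma> \<circ> \<tau> \<circ> inv_into UNIV \<sigma>) ` stabiliser y \<subseteq> stabiliser y"
      using conj_stabiliser[OF s _ assms] by blast
    show "stabiliser y \<subseteq> (\<lambda>\<tau>. \<sigma> \<circ> \<tau> \<circ> inv_into UNIV \<sigma>) ` stabiliser y"
    proof
      fix \<tau> assume t: "\<tau> \<in> stabiliser y"
      have "inv_into UNIV (inv_into UNIV \<sigma>) = \<sigma>" using galD(1)[OF s] by (rule inv_inv_eq)
      then have "inv_into UNIV \<sigma> \<circ> \<tau> \<circ> \<sigma> \<in> stabiliser y"
        using conj_stabiliser[OF inv_gal[OF s] t assms] by simp
      moreover have "\<tau> = \<sigma> \<circ> (inv_into UNIV \<sigma> \<circ> \<tau> \<circ> \<sigma>) \<circ> inv_into UNIV \<sigma>"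
        by (simp add: fun_eq_iff gal_inv_apply[OF s])
      ultimately show "\<tau> \<in> (\<lambda>\<tau>. \<sigma> \<circ> \<tau> \<circ> inv_into UNIV \<sigma>) ` stabiliser y"
        unfolding image_iff by blast
    qed
  qed
  then show ?thesis using id_gal by (auto simp: conj_class_def)
qed

lemma trace_form_in_dress_image:
  assumes "y\<^sup>2 = \<iota> a"
  shows "delta (trace_form \<iota> (fixed_field (stabiliser y))) \<in> dress_image"
proof -
  let ?C = "conj_class \<iota> (stabiliser y)"
  have C: "?C \<in> conj_classes \<iota>"
    using gal_subgroup_stabiliser by (auto simp: conj_classes_def)
  have rep: "class_rep ?C = stabiliser y"
    by (simp add: conj_class_stabiliser[OF assms] class_rep_def)
  have "dress \<iota> (delta ?C) X = delta (trace_form \<iota> (fixed_field (stabiliser y))) X" for X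
    unfolding dress_def delta_def[of ?C] using C rep finite_conj_classes
    by (simp add: if_distrib[of "\<lambda>x. x * _"] cong: if_cong)
  then have "gw_eq (dress \<iota> (delta ?C)) (delta (trace_form \<iota> (fixed_field (stabiliser y))))"
    by (simp add: gw_eq_def gw_rel.zero)
  moreover have "delta ?C \<in> burnside \<iota>" using C by (auto simp: burnside_def delta_def)
  ultimately show ?thesis by (auto simp: dress_image_def)
qed

text \<open>The chosen basis is arbitrary, but its length is the degree, so the size of the matrix
  can be found by counting restrictions of the Galois group.\<close>

lemma trace_form_chosen_basis:
  assumes "intermediate V"
  obtains e where "kbasis \<iota> V e (card (gal_restrict V ` G))"
    "trace_form \<iota> V = mat (card (gal_restrict V ` G)) (card (gal_restrict V ` G))
       (\<lambda>(i, j). ktrace \<iota> V (e i * e j))"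
proof -
  obtain e m where em: "chosen_basis \<iota> V = (e, m)" by (cases "chosen_basis \<iota> V")
  note e = chosen_basis[OF assms em]
  obtain f where "bij_betw f {..<m} (gal_restrict V ` G)"
    using embedding_matrix[OF assms e] by blast
  then have "card (gal_restrict V ` G) = m" using bij_betw_same_card by fastforce
  with e em show ?thesis by (intro that[of e]) (simp_all add: trace_form_def)
qed

text \<open>The stabiliser of 1 is the whole group, with fixed field k. The chosen basis of k over
  itself is some nonzero p, so the trace form is <p^2>, isometric to <1>.\<close>

lemma rank_one_form_1_in_dress_image: "delta (rank_one_form 1) \<in> dress_image"
proof -
  let ?V = "fixed_field (stabiliser 1)"
  have V: "intermediate ?V" by (rule intermediate_fixed_field) (auto simp: stabiliser_def)
  have "stabiliser 1 = G" by (auto simp: stabiliser_def galD)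
  then have range: "?V = range \<iota>" using finite_galois by (simp add: finite_galois_def)
  have "gal_restrict ?V ` G = {gal_restrict ?V id}"
    using id_gal unfolding range by (auto simp: gal_restrict_def fun_eq_iff galD)
  moreover from trace_form_chosen_basis[OF V] obtain e where
    e: "kbasis \<iota> ?V e (card (gal_restrict ?V ` G))"
    and T: "trace_form \<iota> ?V = mat (card (gal_restrict ?V ` G)) (card (gal_restrict ?V ` G))
       (\<lambda>(i, j). ktrace \<iota> ?V (e i * e j))" .
  ultimately have e: "e 0 \<in> ?V" and T: "trace_form \<iota> ?V = rank_one_form (ktrace \<iota> ?V (e 0 * e 0))"
    and tr: "\<iota> (ktrace \<iota> ?V (e 0 * e 0)) = e 0 * e 0"
    using ktrace_eq[OF V, of "e 0 * e 0"] intermediateD(5)[OF V, of "e 0" "e 0"] kbasis_mem[OF e, of 0]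
    by (auto simp: gal_restrict_def intro!: eq_matI)
  obtain p where p: "e 0 = \<iota> p" using e range by blast
  have "\<iota> (ktrace \<iota> ?V (e 0 * e 0)) = \<iota> (p * p)" using tr p by (simp add: hom.hom_mult)
  then have T: "trace_form \<iota> ?V = rank_one_form (p * p)" unfolding T by (simp only: hom.eq_iff)
  have q: "qform (trace_form \<iota> ?V)" using trace_form_sqrt_det(1)[OF V] .
  then have "p \<noteq> 0" by (auto simp: T qform_def det_single)
  then have "isometric (rank_one_form 1) (trace_form \<iota> ?V)"
    unfolding isometric_def T
    by (intro exI[of _ "rank_one_form p"]) (auto simp: det_single scalar_prod_def intro!: eq_matI)
  then show ?thesis
    using dress_image.isometric_iff[OF qform_rank_one q] trace_form_in_dress_image[of 1 1] by simp
qed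

text \<open>The fixed field of the stabiliser is k + k y. Every group element either fixes or
  negates y, and correspondingly fixes or swaps x and \<tau> x. Hence x + \<tau> x and (x - \<tau>
  x) / y are invariant and lie in k; x is recovered after dividing by 2.\<close>

lemma fixed_field_sqrt:
  assumes two: "(2::'k) \<noteq> 0" and y: "y\<^sup>2 = \<iota> a" "y \<notin> range \<iota>"
    and \<tau>: "\<tau> \<in> G" "\<tau> y = - y" and x: "x \<in> fixed_field (stabiliser y)"
  obtains p q where "x = \<iota> p + \<iota> q * y"
proof -
  have two': "(2::'l) \<noteq> 0" using two hom.hom_0_iff[of 2] by (simp add: hom_two)
  have y0: "y \<noteq> 0" using y(2) by (metis hom.hom_zero rangeI)
  have xs: "\<sigma> x = x" if "\<sigma> \<in> G" "\<sigma> y = y" for \<sigma>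
    using x that by (auto simp: fixed_field_def stabiliser_def)
  have fix_\<tau>: "\<sigma> (\<tau> x) = \<tau> x" if s: "\<sigma> \<in> G" "\<sigma> y = y" for \<sigma>
  proof -
    \<comment> \<open>The conjugate of \<sigma> by \<tau> also fixes y, hence fixes x.\<close>
    let ?s = "inv_into UNIV \<tau> \<circ> \<sigma> \<circ> \<tau>"
    have "?s y = y"
      using s gal_inv_apply(2)[OF \<tau>(1), of y] by (simp add: \<tau>(2) galD)
    then have "?s x = x" using s \<tau>(1) by (intro xs comp_gal inv_gal)
    then have "\<tau> (?s x) = \<tau> x" by simp
    then show ?thesis by (simp add: gal_inv_apply[OF \<tau>(1)])
  qed
  have flip: "\<sigma> x = \<tau> x \<and> \<sigma> (\<tau> x) = x" if s: "\<sigma> \<in> G" "\<sigma> y = - y" for \<sigma>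
  proof -
    have "(\<sigma> \<circ> \<tau>) y = y" "(inv_into UNIV \<tau> \<circ> \<sigma>) y = y"
      using s \<tau> gal_inv_apply(2)[OF \<tau>(1), of y] by (simp_all add: galD)
    then have "(\<sigma> \<circ> \<tau>) x = x" "(inv_into UNIV \<tau> \<circ> \<sigma>) x = x"
      using s \<tau> by (blast intro: xs comp_gal inv_gal)+
    then show ?thesis using gal_inv_apply(1)[OF \<tau>(1), of "\<sigma> x"] by simp
  qed
  have "x + \<tau> x \<in> range \<iota>"
  proof (rule fixed_field_gal)
    fix \<sigma> assume s: "\<sigma> \<in> G"
    show "\<sigma> (x + \<tau> x) = x + \<tau> x"
      using gal_sqrt[OF s y(1)] xs[OF s] fix_\<tau>[OF s] flip[OF s] by (auto simp: galD[OF s])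
  qed
  moreover have "(x - \<tau> x) / y \<in> range \<iota>"
  proof (rule fixed_field_gal)
    fix \<sigma> assume s: "\<sigma> \<in> G"
    define z where "z = (x - \<tau> x) / y"
    have z: "z * y = x - \<tau> x" using y0 by (simp add: z_def)
    have d: "\<sigma> (u - v) = \<sigma> u - \<sigma> v" for u v using galD(2,7)[OF s] by (metis diff_conv_add_uminus)
    have "\<sigma> z * \<sigma> y = \<sigma> (x - \<tau> x)" using galD(3)[OF s, of z y] z by simp
    moreover have "\<sigma> y = y \<and> \<sigma> (x - \<tau> x) = x - \<tau> x \<or> \<sigma> y = - y \<and> \<sigma> (x - \<tau> x) = - (x - \<tau> x)"
      using gal_sqrt[OF s y(1)] xs[OF s] fix_\<tau>[OF s] flip[OF s] by (auto simp: d)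
    ultimately have "\<sigma> z * y = z * y"
      unfolding z by (metis minus_mult_right neg_equal_iff_equal)
    then show "\<sigma> ((x - \<tau> x) / y) = (x - \<tau> x) / y" using y0 by (simp flip: z_def)
  qed
  ultimately obtain u v where u: "x + \<tau> x = \<iota> u" and v: "(x - \<tau> x) / y = \<iota> v" by blast
  have "2 * x = \<iota> u + \<iota> v * y" using y0 unfolding u[symmetric] v[symmetric] by simp
  then have "x = \<iota> (u / 2) + \<iota> (v / 2) * y"
    using two' by (simp add: hom.hom_div hom_two field_simps)
  then show ?thesis by (rule that)
qed

text \<open>On k(y) the group restricts to just the identity and y -> -y. In the basis 1, y the
  trace form is thus diagonal with entries 2 and 2a, and the chosen basis gives a congruent
  matrix.\<close>

lemma rank_one_form_sum_in_dress_image: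
  assumes two: "(2::'k) \<noteq> 0" and a: "a \<noteq> 0" and y: "y\<^sup>2 = \<iota> a" "y \<notin> range \<iota>"
  shows "(\<lambda>X. delta (rank_one_form 2) X + delta (rank_one_form (2 * a)) X) \<in> dress_image"
proof -
  let ?V = "fixed_field (stabiliser y)"
  have V: "intermediate ?V" by (rule intermediate_fixed_field) (auto simp: stabiliser_def)
  obtain \<tau> where t: "\<tau> \<in> G" "\<tau> y \<noteq> y" using fixed_field_gal y(2) by blast
  then have t': "\<tau> y = - y" using gal_sqrt y(1) by blast
  note rep = fixed_field_sqrt[OF two y t(1) t']
  have yV: "y \<in> ?V" by (auto simp: fixed_field_def stabiliser_def)
  have res: "gal_restrict ?V \<sigma> = (if \<sigma> y = y then gal_restrict ?V id else gal_restrict ?V \<tau>)"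
    if s: "\<sigma> \<in> G" for \<sigma>
  proof -
    have "\<sigma> x = (if \<sigma> y = y then x else \<tau> x)" if x: "x \<in> ?V" for x
    proof -
      obtain p q where "x = \<iota> p + \<iota> q * y" using rep[OF x] by blast
      then show ?thesis using gal_sqrt[OF s y(1)] t t' by (auto simp: galD s)
    qed
    then show ?thesis by (auto simp: gal_restrict_def fun_eq_iff)
  qed
  have E: "gal_restrict ?V ` G = {gal_restrict ?V id, gal_restrict ?V \<tau>}"
  proof
    have "gal_restrict ?V \<sigma> \<in> {gal_restrict ?V id, gal_restrict ?V \<tau>}" if "\<sigma> \<in> G" for \<sigma>
      by (subst res[OF that]) simp
    then show "gal_restrict ?V ` G \<subseteq> {gal_restrict ?V id, gal_restrict ?V \<tau>}" by blast
  qed (use id_gal t(1) in simp)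
  have ne: "gal_restrict ?V id \<noteq> gal_restrict ?V \<tau>"
  proof
    assume "gal_restrict ?V id = gal_restrict ?V \<tau>"
    from fun_cong[OF this, of y] show False using yV t(2) by (simp add: gal_restrict_def)
  qed
  have card: "card (gal_restrict ?V ` G) = 2" using E ne by simp
  obtain e where e: "kbasis \<iota> ?V e 2" and T: "trace_form \<iota> ?V = mat 2 2 (\<lambda>(i, j). ktrace \<iota> ?V (e i * e j))"
    using trace_form_chosen_basis[OF V] unfolding card .
  have "\<exists>p q. e i = \<iota> p + \<iota> q * y" if "i < 2" for i
    by (rule rep[OF kbasis_mem[OF e that]]) blast
  then obtain p q where pq: "\<And>i. i < 2 \<Longrightarrow> e i = \<iota> (p i) + \<iota> (q i) * y" by metis
  have tr: "ktrace \<iota> ?V (e i * e j) = 2 * p i * p j + 2 * a * q i * q j" if ij: "i < 2" "j < 2" for i j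
  proof -
    have eV: "e i * e j \<in> ?V" using ij kbasis_mem[OF e] intermediateD(5)[OF V] by blast
    have "\<iota> (ktrace \<iota> ?V (e i * e j)) = e i * e j + \<tau> (e i * e j)"
      using ktrace_eq[OF V eV] ne eV unfolding E by (simp add: gal_restrict_def)
    also have "\<dots> = 2 * \<iota> (p i) * \<iota> (p j) + 2 * y\<^sup>2 * \<iota> (q i) * \<iota> (q j)"
      using ij t(1) t' by (simp add: pq galD power2_eq_square algebra_simps)
    also have "\<dots> = \<iota> (2 * p i * p j + 2 * a * q i * q j)"
      by (simp add: y(1) hom_two hom.hom_add hom.hom_mult)
    finally show ?thesis by (simp only: hom.eq_iff)
  qed
  let ?D = "osum (rank_one_form 2) (rank_one_form (2 * a))"
  \<comment> \<open>Column j holds the coordinates of \<open>e j\<close> with respect to 1 and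
    y.\<close>
  let ?P = "mat 2 2 (\<lambda>(i, j). if i = 0 then p j else q j)"
  have D: "?D \<in> carrier_mat 2 2" 
    using osum_carrier[of "rank_one_form 2" 1 "rank_one_form (2 * a)" 1] by (simp add: numeral_2_eq_2)
  have Dq: "qform (rank_one_form 2 :: 'k mat)" "qform (rank_one_form (2 * a))"
    by (rule qform_rank_one, use two a in simp)+
  have P: "?P \<in> carrier_mat 2 2" by simp
  have TP: "transpose_mat ?P * ?D * ?P = trace_form \<iota> ?V"
  proof (rule eq_matI)
    fix i j assume "i < dim_row (trace_form \<iota> ?V)" "j < dim_col (trace_form \<iota> ?V)"
    then have ij: "i < 2" "j < 2" by (simp_all add: T)
    have sum2: "(\<Sum>k<2. f k) = f 0 + f (1::nat)" for f :: "nat \<Rightarrow> 'k"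
      by (simp add: numeral_2_eq_2)
    have "(transpose_mat ?P * ?D * ?P) $$ (i, j) = 2 * p i * p j + 2 * a * q i * q j"
      unfolding congruence_entry[OF D P ij] sum2 using ij by (simp add: osum_def algebra_simps)
    then show "(transpose_mat ?P * ?D * ?P) $$ (i, j) = trace_form \<iota> ?V $$ (i, j)"
      using ij by (simp add: T tr)
  qed (simp_all add: T)
  have q: "qform (trace_form \<iota> ?V)" using trace_form_sqrt_det(1)[OF V] .
  then have "det (trace_form \<iota> ?V) \<noteq> 0" by (simp add: qform_def)
  \<comment> \<open>Invertibility of the base change comes from nondegeneracy of the trace form,
    whose determinant is (det P)^2 times that of \<open>?D\<close>.\<close>
  then have dP: "det ?P \<noteq> 0"
    using det_congruence[OF D P] unfolding TP by fastforce
  have "isometric ?D (trace_form \<iota> ?V)"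
    unfolding isometric_def carrier_matD(1)[OF D] by (intro exI[of _ ?P] conjI P TP dP)
  then have "delta ?D \<in> dress_image"
    using dress_image.isometric_iff[OF qform_osum[OF Dq] q] trace_form_in_dress_image[OF y(1)] by blast
  then show ?thesis using dress_image.osum_iff[OF Dq] by blast
qed

section \<open>All rank one forms lie in the image when k is quadratically closed in L\<close>

lemma isometric_rank_one:
  "b \<noteq> 0 \<Longrightarrow> isometric (rank_one_form (a :: 'k)) (rank_one_form (b\<^sup>2 * a))"
  unfolding isometric_def
  by (intro exI[of _ "rank_one_form b"])
    (auto simp: det_single scalar_prod_def power2_eq_square mult_ac intro!: eq_matI)

lemma rank_one_form_square_class:
  assumes "a \<noteq> 0" "b \<noteq> 0"
  shows "delta (rank_one_form (b\<^sup>2 * a)) \<in> dress_image \<longleftrightarrow> delta (rank_one_form a) \<in> dress_image"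
  by (rule dress_image.isometric_iff[OF qform_rank_one qform_rank_one isometric_rank_one, symmetric])
    (use assms in auto)

lemma dress_surjective_if_squares:
  assumes two: "(2::'k) \<noteq> 0" and sq: "\<And>a. \<exists>y. \<iota> a = y\<^sup>2"
  shows "dress_surjective \<iota>"
proof -
  \<comment> \<open>A square root of a in L either comes from k or generates a quadratic extension,
    whose trace form is <2> + <2a>.\<close>
  have dichotomy: "(\<exists>b. b \<noteq> 0 \<and> a = b\<^sup>2) \<or>
      (\<lambda>X. delta (rank_one_form 2) X + delta (rank_one_form (2 * a)) X) \<in> dress_image"
    if a: "a \<noteq> 0" for a
  proof -
    obtain y where y: "\<iota> a = y\<^sup>2" using sq by blast
    show ?thesis
    proof (cases "y \<in> range \<iota>")
      case True
      then obtain b where "y = \<iota> b" by blast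
      then have "\<iota> a = \<iota> (b\<^sup>2)" using y by (simp add: hom.hom_power)
      then have "a = b\<^sup>2" by (simp only: hom.eq_iff)
      with a show ?thesis by auto
    next
      case False
      then show ?thesis using rank_one_form_sum_in_dress_image[OF two a y[symmetric]] by blast
    qed
  qed
  have squares: "delta (rank_one_form (b\<^sup>2)) \<in> dress_image" if "b \<noteq> 0" for b
    using rank_one_form_square_class[OF one_neq_zero that] rank_one_form_1_in_dress_image
    by (simp only: mult_1_right)
  from squares[OF two] have "delta (rank_one_form (2 * 2)) \<in> dress_image"
    by (simp only: power2_eq_square)
  \<comment> \<open>For a = 2, either <2> is itself the class of a square, or <4> = <1> is
    subtracted from <2> + <4>.\<close>
  then have two_in: "delta (rank_one_form 2) \<in> dress_image"
    using dichotomy[OF two]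
  proof (elim disjE exE conjE)
    fix b :: 'k assume b: "b \<noteq> 0" "2 = b\<^sup>2"
    show ?thesis unfolding b(2) by (rule squares[OF b(1)])
  next
    assume s: "(\<lambda>X. delta (rank_one_form 2) X + delta (rank_one_form (2 * 2)) X) \<in> dress_image"
      and "delta (rank_one_form (2 * 2)) \<in> dress_image"
    from dress_image.diff[OF this] show ?thesis by (simp del: One_nat_def)
  qed
  have "delta (rank_one_form a) \<in> dress_image" if a: "a \<noteq> 0" for a
  proof -
    \<comment> \<open>The dichotomy is applied to 2a. If 2a is a square, then a and 2 lie in the
      same square class; otherwise subtracting <2> from <2> + <4a> leaves <4a> = <a>.\<close>
    have a2: "2 * a \<noteq> 0" using a two by simp
    from dichotomy[OF a2] show ?thesis
    proof (elim disjE exE conjE)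
      fix b :: 'k assume b: "b \<noteq> 0" "2 * a = b\<^sup>2"
      then have "(b / a)\<^sup>2 * a = 2" using a by (simp add: field_simps power2_eq_square)
      with rank_one_form_square_class[OF a, of "b / a"] a b(1) two_in show ?thesis
        by (simp del: One_nat_def)
    next
      assume s: "(\<lambda>X. delta (rank_one_form 2) X + delta (rank_one_form (2 * (2 * a))) X) \<in> dress_image"
      have "2 * (2 * a) = 2\<^sup>2 * a" by (simp only: power2_eq_square mult.assoc)
      with dress_image.diff[OF s two_in] show ?thesis
        using rank_one_form_square_class[OF a two] by (simp del: One_nat_def)
    qed
  qed
  then have "delta A \<in> dress_image" if "qform A" for A
    using dress_image.delta_in_if_rank_one[OF two _ that] by blast
  then have "gw_free \<subseteq> dress_image" by (rule dress_image.gw_free_subset)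
  then show ?thesis unfolding dress_surjective_def dress_image_def by blast
qed

end

theorem theorem1p3:
  fixes \<iota> :: "'k::field \<Rightarrow> 'l::field"
  assumes "(2::'k) \<noteq> 0"
    and "field_hom \<iota>"
    and "finite_galois \<iota>"
  shows "dress_surjective \<iota> \<longleftrightarrow> (\<forall>a. \<exists>y. \<iota> a = y ^ 2)"
proof -
  interpret finite_galois_extension \<iota>
    using assms(2,3) by unfold_locales
  show ?thesis
    using square_if_dress_surjective dress_surjective_if_squares[OF assms(1)] by blast
qed

end
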